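(* Let $K$ be a strictly concave kernel function which either satisfies condition $(\infty')$ or belongs to $\mathrm{C}^1(0,2\pi)$. Let $r_0,r_1,\dots,r_n>0$, $K_j:=r_jK$, and \[F(\mathbf{y},t)=K_0(t)+\sum_{j=1}^nK_j(t-y_j)=r_0K(t)+\sum_{j=1}^nr_jK(t-y_j).\] Let $S=S_\sigma$ be a simplex. Then there is a unique $\mathbf{w}^*=(w_1,\dots,w_n)\in S$ with \[M(S):=\inf_{\mathbf{y}\in S}\sup_{t\in\mathbb{T}}F(\mathbf{y},t)=\sup_{t\in\mathbb{T}}F(\mathbf{w}^*,t).\] Moreover: (a) the nodes $w_0=0,w_1,\dots,w_n$ are different and $\mathbf{w}^*$ is an equioscillation point, $m_0(\mathbf{w}^* )=\dots=m_n(\mathbf{w}^* )$; (b) $\inf_{\mathbf{y}\in S}\max_{j}\sup_{t\in I_j(\mathbf{y})}F(\mathbf{y},t)=M(S)=m(S)=\sup_{\mathbf{y}\in S}\min_j\sup_{t\in I_j(\mathbf{y})}F(\mathbf{y},t)$; (c) the Sandwich Property holds in $\overline{S}$: for all $\mathbf{x},\mathbf{y}\in\overline{S}$, $\underline{m}(\mathbf{x})\le M(S)\le\overline{m}(\mathbf{y})$.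
   Context: Identify the torus $\mathbb{T}=\mathbb{R}/2\pi\mathbb{Z}$ with $[0,2\pi)$. A concave kernel function is a $2\pi$-periodic function $K:\mathbb{R}\to[-\infty,\infty)$ which is real-valued and concave on $(0,2\pi)$ and such that $\lim_{t\downarrow0}K(t)$ and $\lim_{t\uparrow2\pi}K(t)$ exist in $[-\infty,\infty)$ and are equal; it is strictly concave if strictly concave on $(0,2\pi)$. Condition $(\infty')$: either $\lim_{t\uparrow2\pi}D_\pm K(t)=-\infty$ (both one-sided derivatives), or $\lim_{t\downarrow0}D_\pm K(t)=+\infty$. For $\mathbf{y}\in\mathbb{T}^n$ put $y_0=0$, $y_{n+1}=2\pi$. For a permutation $\sigma$ of $\{1,\dots,n\}$ with $\sigma(0)=0,\sigma(n+1)=n+1$, $S_\sigma=\{\mathbf{y}:0<y_{\sigma(1)}<\dots<y_{\sigma(n)}<2\pi\}$ and $\overline{S_\sigma}$ is the set where $0\le y_{\sigma(1)}\le\dots\le y_{\sigma(n)}\le2\pi$. For $\mathbf{y}\in\overline{S_\sigma}$: $I_{\sigma(k)}(\mathbf{y})=[y_{\sigma(k)},y_{\sigma(k+1)}]$, $m_{\sigma(k)}(\mathbf{y})=\sup_{t\in I_{\sigma(k)}(\mathbf{y})}F(\mathbf{y},t)$ ($k=0,\dots,n$), $\overline{m}=\max_jm_j$, $\underline{m}=\min_jm_j$, $m(S)=\sup_{\mathbf{y}\in S}\underline{m}(\mathbf{y})$. An equioscillation point is a $\mathbf{y}$ with all $m_j(\mathbf{y})$ equal.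
   Formalization: The kernel's value K(0) is taken to be the common limit of K at 0+ and 2π−; if K(0) may exceed this limit the claim fails (e.g. K(t)=−(t−π)² on (0,2π), K(0)=1000, n=1, r_0=1, r_1=10: the infimum over S is not attained). *)

theory Defs
  imports "HOL-Analysis.Analysis" "HOL-Combinatorics.Permutations"
begin

(* Kernels take values in [-\<infinity>,\<infinity>); we use ereal and require K t \<noteq> \<infinity>. *)

definition strictly_concave_on :: "real set \<Rightarrow> (real \<Rightarrow> real) \<Rightarrow> bool" where
  "strictly_concave_on S f \<longleftrightarrow> convex S \<and>
     (\<forall>x\<in>S. \<forall>y\<in>S. x \<noteq> y \<longrightarrow> (\<forall>u::real. 0 < u \<and> u < 1 \<longrightarrow>
        u * f x + (1 - u) * f y < f (u * x + (1 - u) * y)))"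

definition concave_kernel :: "(real \<Rightarrow> ereal) \<Rightarrow> bool" where
  "concave_kernel K \<longleftrightarrow>
     (\<forall>t. K (t + 2 * pi) = K t) \<and>
     (\<forall>t. K t \<noteq> \<infinity>) \<and>
     (\<forall>t\<in>{0<..<2*pi}. \<bar>K t\<bar> \<noteq> \<infinity>) \<and>
     concave_on {0<..<2*pi} (\<lambda>t. real_of_ereal (K t)) \<and>
     (K \<longlongrightarrow> K 0) (at_right 0) \<and>
     (K \<longlongrightarrow> K 0) (at_left (2 * pi))"

definition strictly_concave_kernel :: "(real \<Rightarrow> ereal) \<Rightarrow> bool" where
  "strictly_concave_kernel K \<longleftrightarrow> concave_kernel K \<and>
     strictly_concave_on {0<..<2*pi} (\<lambda>t. real_of_ereal (K t))"

definition right_deriv :: "(real \<Rightarrow> real) \<Rightarrow> real \<Rightarrow> real" where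
  "right_deriv f t = Lim (at_right 0) (\<lambda>h. (f (t + h) - f t) / h)"

definition left_deriv :: "(real \<Rightarrow> real) \<Rightarrow> real \<Rightarrow> real" where
  "left_deriv f t = Lim (at_left 0) (\<lambda>h. (f (t + h) - f t) / h)"

definition cond_infty' :: "(real \<Rightarrow> ereal) \<Rightarrow> bool" where
  "cond_infty' K \<longleftrightarrow>
    (let k = (\<lambda>t. real_of_ereal (K t)) in
     (filterlim (right_deriv k) at_bot (at_left (2 * pi)) \<and>
      filterlim (left_deriv k) at_bot (at_left (2 * pi))) \<or>
     (filterlim (right_deriv k) at_top (at_right 0) \<and>
      filterlim (left_deriv k) at_top (at_right 0)))"

definition C1_kernel :: "(real \<Rightarrow> ereal) \<Rightarrow> bool" where
  "C1_kernel K \<longleftrightarrow>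
    (let k = (\<lambda>t. real_of_ereal (K t)) in
     (\<forall>t\<in>{0<..<2*pi}. k differentiable (at t)) \<and>
     continuous_on {0<..<2*pi} (deriv k))"

definition sumF :: "(real \<Rightarrow> ereal) \<Rightarrow> (nat \<Rightarrow> real) \<Rightarrow> nat \<Rightarrow> (nat \<Rightarrow> real) \<Rightarrow> real \<Rightarrow> ereal" where
  "sumF K r n y t = ereal (r 0) * K t + (\<Sum>j\<in>{1..n}. ereal (r j) * K (t - y j))"

definition node :: "nat \<Rightarrow> (nat \<Rightarrow> real) \<Rightarrow> nat \<Rightarrow> real" where
  "node n y k = (if k = 0 then 0 else if k = n + 1 then 2 * pi else y k)"

(* points y \<in> \<real>^n are functions on {1..n} (extensional) *)
definition simplex_S :: "nat \<Rightarrow> (nat \<Rightarrow> nat) \<Rightarrow> (nat \<Rightarrow> real) set" where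
  "simplex_S n \<sigma> = {y \<in> PiE {1..n} (\<lambda>_. UNIV). \<forall>k\<le>n. node n y (\<sigma> k) < node n y (\<sigma> (Suc k))}"

definition closed_simplex_S :: "nat \<Rightarrow> (nat \<Rightarrow> nat) \<Rightarrow> (nat \<Rightarrow> real) set" where
  "closed_simplex_S n \<sigma> = {y \<in> PiE {1..n} (\<lambda>_. UNIV). \<forall>k\<le>n. node n y (\<sigma> k) \<le> node n y (\<sigma> (Suc k))}"

(* I_{\<sigma>(k)}(y) = [y_{\<sigma>(k)}, y_{\<sigma>(k+1)}], i.e. I_j = [y_j, y_{\<sigma>(\<sigma>^{-1}(j)+1)}] *)
definition Ival :: "nat \<Rightarrow> (nat \<Rightarrow> nat) \<Rightarrow> (nat \<Rightarrow> real) \<Rightarrow> nat \<Rightarrow> real set" where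
  "Ival n \<sigma> y j = {node n y j .. node n y (\<sigma> (Suc (inv \<sigma> j)))}"

definition mloc :: "(real \<Rightarrow> ereal) \<Rightarrow> (nat \<Rightarrow> real) \<Rightarrow> nat \<Rightarrow> (nat \<Rightarrow> nat) \<Rightarrow> (nat \<Rightarrow> real) \<Rightarrow> nat \<Rightarrow> ereal" where
  "mloc K r n \<sigma> y j = (SUP t\<in>Ival n \<sigma> y j. sumF K r n y t)"

definition mbar :: "(real \<Rightarrow> ereal) \<Rightarrow> (nat \<Rightarrow> real) \<Rightarrow> nat \<Rightarrow> (nat \<Rightarrow> nat) \<Rightarrow> (nat \<Rightarrow> real) \<Rightarrow> ereal" where
  "mbar K r n \<sigma> y = Max ((\<lambda>j. mloc K r n \<sigma> y j) ` {0..n})"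

definition munder :: "(real \<Rightarrow> ereal) \<Rightarrow> (nat \<Rightarrow> real) \<Rightarrow> nat \<Rightarrow> (nat \<Rightarrow> nat) \<Rightarrow> (nat \<Rightarrow> real) \<Rightarrow> ereal" where
  "munder K r n \<sigma> y = Min ((\<lambda>j. mloc K r n \<sigma> y j) ` {0..n})"

(* M(S) = inf_{y \<in> S} sup_{t \<in> \<T>} F(y,t), \<T> identified with [0,2\<pi>) *)
definition minimax :: "(real \<Rightarrow> ereal) \<Rightarrow> (nat \<Rightarrow> real) \<Rightarrow> nat \<Rightarrow> (nat \<Rightarrow> nat) \<Rightarrow> ereal" where
  "minimax K r n \<sigma> = (INF y\<in>simplex_S n \<sigma>. SUP t\<in>{0..<2*pi}. sumF K r n y t)"

definition maximin :: "(real \<Rightarrow> ereal) \<Rightarrow> (nat \<Rightarrow> real) \<Rightarrow> nat \<Rightarrow> (nat \<Rightarrow> nat) \<Rightarrow> ereal" where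
  "maximin K r n \<sigma> = (SUP y\<in>simplex_S n \<sigma>. munder K r n \<sigma> y)"

end

theory Submission
  imports Defs
begin

text \<open>
  Relabelling by the permutation and unrolling the circle turns a point of the closed simplex into a
  sequence z of nodes with z (j + N) = z j + 2 pi; translating or rotating the index of such a
  sequence changes neither the potential's maximum nor its gap maxima, so node 0 may move freely.

  Moving two nodes apart with their weighted centre fixed lowers the potential outside the arc
  between them, by strict concavity. No node is a global maximum point of the potential; this is where
  the regularity condition enters. Hence, if some gap maximum lies below the global maximum, spreading
  the two nodes bounding that gap lowers the global maximum, and if some gap maximum lies above the
  least one, contracting that gap raises all the others. By compactness both extremal problems have
  solutions, and these equioscillate. Two equioscillating configurations x, y coincide: align them at
  an index i maximizing y i - x i and compare the maximum of x in the gap before i with that of y in the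
  gap after i by a four-point concavity inequality. So both problems have the same unique solution.
\<close>

section \<open>Strictly concave kernels\<close>

text \<open>The theorem pins one node at 0 and gives it a weight of its own, yet the moves must be
  able to displace that node too; hence a circle of equal nodes, with the weights rotated along.
  Compactness yields extremal configurations only where nodes may coincide. A collapsed gap has a
  node value as its maximum, so the fact about nodes serves twice: it lets a block of coinciding
  nodes be pulled apart, and it excludes collapsed gaps once equioscillation is known. For finite
  \<open>K 0\<close> this fact is beyond strict concavity: the convex kink of \<open>K\<close> at 0
  could be outweighed by a concave kink of another summand. Condition (infinity') makes the kink at
  the node steeper, on one side, than anything against it; \<open>C1_kernel\<close> forbids all
  other kinks.\<close>

locale strict_kernel =
  fixes K :: "real \<Rightarrow> ereal"
  assumes strict: "strictly_concave_kernel K"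
begin

abbreviation k :: "real \<Rightarrow> real" where "k t \<equiv> real_of_ereal (K t)"

lemma kernel_not_PInf [simp]: "K t \<noteq> \<infinity>"
  using strict unfolding strictly_concave_kernel_def concave_kernel_def by blast

lemma kernel_finite: "0 < t \<Longrightarrow> t < 2*pi \<Longrightarrow> \<bar>K t\<bar> \<noteq> \<infinity>"
  using strict unfolding strictly_concave_kernel_def concave_kernel_def by auto

lemma kernel_shift [simp]: "K (t + 2*pi) = K t"
  using strict unfolding strictly_concave_kernel_def concave_kernel_def by blast

lemma kernel_shift_int: "K (t + of_int m * (2*pi)) = K t"
proof -
  interpret periodic_fun_simple K "2*pi" by standard simp
  show ?thesis by (rule plus_of_int)
qed

lemma kernel_2pi [simp]: "K (2*pi) = K 0" "K (pi*2) = K 0"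
  using kernel_shift[of 0] by (simp_all add: mult.commute)

lemma reduce_mod_2pi:
  obtains m :: int and u where "t = u + of_int m * (2*pi)" "0 \<le> u" "u < 2*pi"
proof
  define m where "m = \<lfloor>t / (2*pi)\<rfloor>"
  have "of_int m \<le> t / (2*pi)" "t / (2*pi) < of_int m + 1"
    unfolding m_def by linarith+
  then show "0 \<le> t - of_int m * (2*pi)" "t - of_int m * (2*pi) < 2*pi"
    by (simp_all add: field_simps)
qed simp

text \<open>Concavity gives continuity inside a period, the two one-sided limits give it at 0, and
  periodicity carries it everywhere. With \<open>ereal\<close> as target this includes a value
  -infinity at 0.\<close>

lemma isCont_kernel: "isCont K t"
proof -
  have interior: "isCont K u" if "0 < u" "u < 2*pi" for u
  proof -
    have "convex_on {0<..<2*pi} (\<lambda>t. - k t)"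
      using strict unfolding strictly_concave_kernel_def concave_kernel_def concave_on_def by blast
    then have "continuous_on {0<..<2*pi} (\<lambda>t. - (- k t))"
      by (intro continuous_on_minus convex_on_continuous) auto
    then have "continuous_on {0<..<2*pi} (\<lambda>t. ereal (k t))"
      by (intro continuous_on_ereal) auto
    then have "continuous_on {0<..<2*pi} K"
      by (rule continuous_on_cong[THEN iffD1, rotated 2]) (auto simp: ereal_real' kernel_finite)
    with that show ?thesis
      by (auto simp: continuous_on_eq_continuous_at)
  qed
  have zero: "isCont K 0"
  proof -
    have "(K \<longlongrightarrow> K 0) (at_right 0)" and L: "(K \<longlongrightarrow> K 0) (at_left (2*pi))"
      using strict unfolding strictly_concave_kernel_def concave_kernel_def by blast+
    moreover have "((\<lambda>s. K (s + 2*pi)) \<longlongrightarrow> K 0) (at_left 0)"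
    proof (rule filterlim_compose[OF L])
      show "filterlim (\<lambda>s. s + 2*pi) (at_left (2*pi)) (at_left (0::real))"
        unfolding filterlim_at
        by (auto intro!: tendsto_eq_intros simp: eventually_at_left_field intro: exI[of _ "-1"])
    qed
    ultimately show ?thesis
      by (simp add: isCont_def filterlim_split_at)
  qed
  obtain m u where u: "t = u + of_int m * (2*pi)" "0 \<le> u" "u < 2*pi"
    by (rule reduce_mod_2pi)
  have "isCont K u"
    using interior zero u by (cases "u = 0") auto
  moreover have "K = (\<lambda>s. K (s - of_int m * (2*pi)))"
    using kernel_shift_int[of _ m] by (metis diff_add_cancel)
  moreover have "isCont (\<lambda>s. K (s - of_int m * (2*pi))) t" if "isCont K u"
    using that u by (intro isCont_o2[of t "\<lambda>s. s - of_int m * (2*pi)" K]) auto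
  ultimately show ?thesis by simp
qed

lemma kernel_finite_everywhere:
  assumes "K 0 \<noteq> -\<infinity>"
  shows "\<bar>K t\<bar> \<noteq> \<infinity>"
proof -
  obtain m u where u: "t = u + of_int m * (2*pi)" "0 \<le> u" "u < 2*pi"
    by (rule reduce_mod_2pi)
  have "\<bar>K u\<bar> \<noteq> \<infinity>"
    using assms kernel_not_PInf[of 0] kernel_finite[of u] u by (cases "u = 0") (auto simp: ereal_infinity_cases)
  then show ?thesis
    using u kernel_shift_int by simp
qed

lemma isCont_k:
  assumes "K 0 \<noteq> -\<infinity>"
  shows "isCont k t"
  using isCont_kernel[of t] kernel_finite_everywhere[OF assms, of t]
  unfolding isCont_def by (auto intro: lim_real_of_ereal simp: ereal_real')

section \<open>Chord and slope inequalities\<close>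

lemma chord_interior:
  assumes "0 < a" "a < b" "b < c" "c < 2*pi"
  shows "(c - b) * k a + (b - a) * k c < (c - a) * k b"
proof -
  define u where "u = (c - b) / (c - a)"
  have u: "0 < u" "u < 1" "1 - u = (b - a) / (c - a)"
    using assms by (auto simp: u_def field_simps)
  have "u * (c - a) = c - b"
    using assms by (simp add: u_def)
  then have b: "u * a + (1 - u) * c = b"
    by (simp add: algebra_simps)
  have "u * k a + (1 - u) * k c < k (u * a + (1 - u) * c)"
    using strict assms u(1,2) unfolding strictly_concave_kernel_def strictly_concave_on_def by simp
  then have "(c - a) * (u * k a + (1 - u) * k c) < (c - a) * k b"
    using assms unfolding b by simp
  moreover have "(c - a) * (u * k a + (1 - u) * k c) = (c - b) * k a + (b - a) * k c"
  proof -
    have "(c - a) * (u * k a + (1 - u) * k c) = (u * (c - a)) * k a + ((1 - u) * (c - a)) * k c"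
      by (simp add: algebra_simps)
    also have "(1 - u) * (c - a) = b - a"
      using \<open>u * (c - a) = c - b\<close> by (simp add: algebra_simps)
    finally show ?thesis
      using \<open>u * (c - a) = c - b\<close> by simp
  qed
  ultimately show ?thesis by simp
qed

text \<open>For finite \<open>K 0\<close> the function \<open>k\<close> is continuous at the end
  points of the period, so \<open>a\<close> and \<open>c\<close> may be approached from inside. The
  limit costs strictness, which \<open>slope_strict\<close> recovers by inserting two
  midpoints.\<close>

lemma chord_le:
  assumes "K 0 \<noteq> -\<infinity>" "0 \<le> a" "a < b" "b < c" "c \<le> 2*pi"
  shows "(c - b) * k a + (b - a) * k c \<le> (c - a) * k b"
proof -
  define A where "A e = a + e * (b - a)" for e
  define C where "C e = c - e * (c - b)" for e
  have k: "((\<lambda>e. k (g e)) \<longlongrightarrow> k l) (at_right 0)" if "(g \<longlongrightarrow> l) (at_right (0::real))" for g l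
    using isCont_tendsto_compose[OF isCont_k[OF assms(1)] that] .
  have A: "(A \<longlongrightarrow> a) (at_right 0)" and C: "(C \<longlongrightarrow> c) (at_right 0)"
    unfolding A_def C_def by (auto intro!: tendsto_eq_intros)
  have lhs: "((\<lambda>e. (C e - b) * k (A e) + (b - A e) * k (C e)) \<longlongrightarrow> (c - b) * k a + (b - a) * k c) (at_right 0)"
    by (intro tendsto_intros k A C)
  have rhs: "((\<lambda>e. (C e - A e) * k b) \<longlongrightarrow> (c - a) * k b) (at_right 0)"
    by (intro tendsto_intros A C)
  have "\<forall>\<^sub>F e in at_right 0. (C e - b) * k (A e) + (b - A e) * k (C e) \<le> (C e - A e) * k b"
  proof -
    have "(C e - b) * k (A e) + (b - A e) * k (C e) \<le> (C e - A e) * k b" if "0 < e" "e < 1" for e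
    proof (rule less_imp_le[OF chord_interior])
      have "0 < e * (b - a)" "0 < e * (c - b)" "e * (b - a) < b - a" "e * (c - b) < c - b"
        using that assms by (auto simp: mult_less_cancel_right2)
      then show "0 < A e" "A e < b" "b < C e" "C e < 2*pi"
        using assms unfolding A_def C_def by linarith+
    qed
    then show ?thesis
      by (auto simp: eventually_at_right_field intro: exI[of _ 1])
  qed
  then show ?thesis
    by (intro tendsto_le[OF _ rhs lhs]) auto
qed

lemma slope_antimono:
  assumes "K 0 \<noteq> -\<infinity>" "0 \<le> a" "a < b" "b < c" "c \<le> 2*pi"
  shows "(k c - k a) / (c - a) \<le> (k b - k a) / (b - a)"
    and "(k c - k b) / (c - b) \<le> (k c - k a) / (c - a)"
    and "(k c - k b) / (c - b) \<le> (k b - k a) / (b - a)"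
  using chord_le[OF assms] assms by (simp_all add: field_simps)

lemma slope_strict:
  assumes "K 0 \<noteq> -\<infinity>" "0 \<le> a" "a < b" "b < c" "c \<le> 2*pi"
  shows "(k c - k b) / (c - b) < (k b - k a) / (b - a)"
proof -
  define a' where "a' = (a + b) / 2"
  define c' where "c' = (b + c) / 2"
  have ord: "a < a'" "a' < b" "b < c'" "c' < c"
    using assms by (auto simp: a'_def c'_def)
  have "(k c - k b) / (c - b) \<le> (k c' - k b) / (c' - b)"
    using assms ord by (intro slope_antimono) auto
  also have "\<dots> < (k b - k a') / (b - a')"
    using chord_interior[of a' b c'] assms ord by (simp add: field_simps)
  also have "\<dots> \<le> (k b - k a) / (b - a)"
    using assms ord by (intro slope_antimono) auto
  finally show ?thesis .
qed

lemma slope_interior: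
  assumes "0 < a" "a < b" "b < c" "c < 2*pi"
  shows "(k c - k b) / (c - b) < (k b - k a) / (b - a)"
  using chord_interior[OF assms] assms by (simp add: field_simps)

text \<open>If \<open>K 0\<close> is -infinity, then \<open>k 0\<close> is the default value 0 of
  \<open>real_of_ereal\<close>; in that case slopes are compared only strictly inside the
  period.\<close>

lemma slope_strict_disjoint:
  assumes "0 \<le> a" "a < b" "b \<le> c" "c < d" "d \<le> 2*pi" "K 0 \<noteq> -\<infinity> \<or> 0 < a \<and> d < 2*pi"
  shows "(k d - k c) / (d - c) < (k b - k a) / (b - a)"
proof -
  have *: "(k w - k v) / (w - v) < (k v - k u) / (v - u)"
    if "a \<le> u" "u < v" "v < w" "w \<le> d" for u v w
    using assms that slope_strict[of u v w] slope_interior[of u v w] by auto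
  show ?thesis
  proof (cases "b = c")
    case False
    then show ?thesis
      using *[of a b c] *[of b c d] assms by fastforce
  qed (use * assms in auto)
qed

text \<open>This inequality drives both the moves of nodes and the uniqueness proof. By
  \<open>bal\<close> the weighted centre is fixed, so the two slopes of
  \<open>slope_strict_disjoint\<close> enter with equal factors. If an outer value is -infinity the
  inequality stays strict, because \<open>b\<close> and \<open>c\<close> lie inside the
  period.\<close>

lemma kernel_spread:
  assumes "0 \<le> a" "a < b" "b \<le> c" "c < d" "d \<le> 2*pi" "p > 0" "q > 0"
    and bal: "p * (d - c) = q * (b - a)"
  shows "ereal p * K d + ereal q * K a < ereal p * K c + ereal q * K b"
proof -
  have fin: "\<bar>K b\<bar> \<noteq> \<infinity>" "\<bar>K c\<bar> \<noteq> \<infinity>"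
    using assms kernel_finite[of b] kernel_finite[of c] by simp_all
  show ?thesis
  proof (cases "K a = -\<infinity> \<or> K d = -\<infinity>")
    case True
    then have L: "ereal p * K d + ereal q * K a = -\<infinity>"
      using assms kernel_not_PInf[of a] kernel_not_PInf[of d]
      by (cases "K a"; cases "K d") auto
    show ?thesis
      unfolding L using fin by (cases "K b"; cases "K c") auto
  next
    case False
    have "K 0 \<noteq> -\<infinity> \<or> 0 < a \<and> d < 2*pi"
      using False assms by (metis kernel_2pi(1) order_le_less)
    then have "(k d - k c) / (d - c) < (k b - k a) / (b - a)"
      using assms by (intro slope_strict_disjoint) auto
    then have "(p * (d - c)) * ((k d - k c) / (d - c)) < (q * (b - a)) * ((k b - k a) / (b - a))"
      unfolding bal using assms by (intro mult_strict_left_mono) auto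
    moreover have "(p * (d - c)) * ((k d - k c) / (d - c)) = p * (k d - k c)"
      "(q * (b - a)) * ((k b - k a) / (b - a)) = q * (k b - k a)"
      using assms(1-5) by simp_all
    ultimately have "p * k d + q * k a < p * k c + q * k b"
      by (simp add: algebra_simps)
    then show ?thesis
      using False fin kernel_not_PInf[of a] kernel_not_PInf[of d]
      by (cases "K a"; cases "K b"; cases "K c"; cases "K d") auto
  qed
qed

section \<open>One-sided derivatives and steepness at the singularity\<close>

lemma right_deriv_tendsto:
  assumes fin: "K 0 \<noteq> -\<infinity>" and t: "0 < t" "t < 2*pi"
  shows "((\<lambda>h. (k (t + h) - k t) / h) \<longlongrightarrow> right_deriv k t) (at_right 0)"
proof -
  \<comment> \<open>The sign turns the decreasing difference quotient into an increasing one. The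
    chord over \<open>[0, t]\<close> bounds it, so the \<open>Lim\<close> in
    \<open>right_deriv\<close> is a true limit.\<close>
  define g where "g h = - ((k (t + h) - k t) / h)" for h
  have "(g \<longlongrightarrow> Inf (g ` ({0<..} \<inter> {..<2*pi - t}))) (at 0 within ({0<..} \<inter> {..<2*pi - t}))"
  proof (rule Lim_right_bound)
    fix a b assume "a \<in> {..<2*pi - t}" "b \<in> {..<2*pi - t}" "0 < a" "a \<le> b"
    then show "g a \<le> g b"
      using slope_antimono(1)[OF fin, of t "t + a" "t + b"] t unfolding g_def
      by (cases "a = b") auto
  next
    fix a assume "a \<in> {..<2*pi - t}" "0 < a"
    then show "- ((k t - k 0) / (t - 0)) \<le> g a"
      using slope_antimono(3)[OF fin, of 0 t "t + a"] t unfolding g_def by auto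
  qed
  moreover have "at 0 within ({0<..} \<inter> {..<2*pi - t}) = at_right 0"
    using t by (intro at_within_nhd[of _ "{..<2*pi - t}"]) auto
  ultimately have "((\<lambda>h. - g h) \<longlongrightarrow> - Inf (g ` ({0<..} \<inter> {..<2*pi - t}))) (at_right 0)"
    by (intro tendsto_minus) simp
  then show ?thesis
    unfolding g_def right_deriv_def by (simp add: tendsto_Lim)
qed

lemma right_deriv_le_slope:
  assumes fin: "K 0 \<noteq> -\<infinity>" and t: "0 < t" "t < 2*pi"
  shows "right_deriv k t \<le> (k t - k 0) / t"
proof (rule tendsto_upperbound[OF right_deriv_tendsto[OF assms]])
  have "(k (t + h) - k t) / h \<le> (k t - k 0) / t" if "0 < h" "h < 2*pi - t" for h
    using slope_antimono(3)[OF fin, of 0 t "t + h"] t that by auto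
  then show "\<forall>\<^sub>F h in at_right 0. (k (t + h) - k t) / h \<le> (k t - k 0) / t"
    using t by (auto simp: eventually_at_right_field intro!: exI[of _ "2*pi - t"])
qed simp

lemma right_deriv_ge_slope:
  assumes fin: "K 0 \<noteq> -\<infinity>" and t: "0 < t" "t < 2*pi"
  shows "(k (2*pi) - k t) / (2*pi - t) \<le> right_deriv k t"
proof (rule tendsto_lowerbound[OF right_deriv_tendsto[OF assms]])
  have "(k (2*pi) - k t) / (2*pi - t) \<le> (k (t + h) - k t) / h" if "0 < h" "h < 2*pi - t" for h
    using slope_antimono(1)[OF fin, of t "t + h" "2*pi"] t that by auto
  then show "\<forall>\<^sub>F h in at_right 0. (k (2*pi) - k t) / (2*pi - t) \<le> (k (t + h) - k t) / h"
    using t by (auto simp: eventually_at_right_field intro!: exI[of _ "2*pi - t"])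
qed simp

text \<open>By periodicity both alternatives of \<open>cond_infty'\<close> say that \<open>K\<close>
  rises infinitely steeply on leaving 0, to the right (\<open>s = 1\<close>) or to the left
  (\<open>s = -1\<close>). Derivatives pass to difference quotients by comparison with the chord
  that ends at the singularity.\<close>

lemma infty_slope_at_zero:
  assumes fin: "K 0 \<noteq> -\<infinity>" and "cond_infty' K"
  obtains s :: real where "s = 1 \<or> s = -1"
    "\<And>X. \<forall>\<^sub>F e in at_right 0. X \<le> (k (s * e) - k 0) / e"
proof -
  consider "filterlim (right_deriv k) at_bot (at_left (2*pi))" | "filterlim (right_deriv k) at_top (at_right 0)"
    using assms(2) unfolding cond_infty'_def Let_def by blast
  then show thesis
  proof cases
    case 1
    have "\<forall>\<^sub>F e in at_right 0. X \<le> (k (- 1 * e) - k 0) / e" for X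
    proof -
      have "filterlim (\<lambda>e. 2*pi - e) (at_left (2*pi)) (at_right (0::real))"
        unfolding filterlim_at
        by (auto intro!: tendsto_eq_intros simp: eventually_at_right_field intro: exI[of _ 1])
      then have "filterlim (\<lambda>e. right_deriv k (2*pi - e)) at_bot (at_right 0)"
        by (rule filterlim_compose[OF 1])
      then have "\<forall>\<^sub>F e in at_right 0. right_deriv k (2*pi - e) \<le> - X"
        unfolding filterlim_at_bot by blast
      moreover have "\<forall>\<^sub>F e in at_right 0. 0 < e \<and> e < 2*pi"
        by (auto simp: eventually_at_right_field intro!: exI[of _ "2*pi"])
      ultimately show ?thesis
      proof eventually_elim
        case (elim e)
        have "(k (2*pi) - k (2*pi - e)) / e \<le> - X"
          using right_deriv_ge_slope[OF fin, of "2*pi - e"] elim by simp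
        moreover have "K (2*pi - e) = K (- 1 * e)"
          using kernel_shift[of "-e"] by (simp add: algebra_simps)
        ultimately show ?case
          using elim by (simp add: field_simps)
      qed
    qed
    then show thesis using that[of "-1"] by blast
  next
    case 2
    have "\<forall>\<^sub>F e in at_right 0. X \<le> (k (1 * e) - k 0) / e" for X
    proof -
      have "\<forall>\<^sub>F e in at_right 0. X \<le> right_deriv k e"
        using 2 unfolding filterlim_at_top by blast
      moreover have "\<forall>\<^sub>F e in at_right 0. 0 < e \<and> e < 2*pi"
        by (auto simp: eventually_at_right_field intro!: exI[of _ "2*pi"])
      ultimately show ?thesis
        by eventually_elim (use right_deriv_le_slope[OF fin] in \<open>fastforce intro: order_trans\<close>)
    qed
    then show thesis using that[of 1] by blast
  qed
qed

text \<open>By concavity the slope over the fixed step \<open>d\<close> bounds the slopes over all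
  shorter steps in the same direction; half the distance to the boundary keeps that step inside the
  period.\<close>

lemma difference_quotient_bounded_below:
  assumes u: "0 < u" "u < 2*pi" and s: "s = 1 \<or> s = (-1::real)"
  shows "\<exists>L. \<forall>\<^sub>F e in at_right 0. L \<le> (k (u + s * e) - k u) / e"
proof -
  define d where "d = min u (2*pi - u) / 2"
  have d: "0 < d" "0 < u + s * d" "u + s * d < 2*pi"
    using u s by (auto simp: d_def min_def field_simps)
  have conc: "concave_on {0<..<2*pi} k"
    using strict unfolding strictly_concave_kernel_def concave_kernel_def by blast
  have "(k (u + s * d) - k u) / d \<le> (k (u + s * e) - k u) / e" if e: "0 < e" "e < d" for e
  proof -
    have "u + s * e = (1 - e / d) * u + (e / d) * (u + s * d)"
      using d by (simp add: field_simps)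
    then have "(1 - e / d) * k u + (e / d) * k (u + s * d) \<le> k (u + s * e)"
      using concave_onD[OF conc, of "e / d" u "u + s * d"] u d e by auto
    then have "(e / d) * (k (u + s * d) - k u) \<le> k (u + s * e) - k u"
      by (simp add: algebra_simps)
    then show ?thesis
      using d e by (simp add: field_simps)
  qed
  then have "\<forall>\<^sub>F e in at_right 0. (k (u + s * d) - k u) / d \<le> (k (u + s * e) - k u) / e"
    using d by (auto simp: eventually_at_right_field intro!: exI[of _ d])
  then show ?thesis ..
qed

text \<open>On leaving the node towards the steep side, summand \<open>i\<close> gains at an
  arbitrarily large rate, while every other summand loses at most at a bounded rate.\<close>

lemma no_max_at_singularity_infty:
  fixes N i :: nat
  assumes fin: "K 0 \<noteq> -\<infinity>" and "cond_infty' K"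
    and r: "\<And>j. j < N \<Longrightarrow> r j > 0"
    and u: "\<And>j. j < N \<Longrightarrow> 0 \<le> u j \<and> u j < 2*pi" and i: "i < N" "u i = 0"
  shows "\<exists>s. (\<Sum>j<N. r j * k (u j)) < (\<Sum>j<N. r j * k (u j + s))"
proof (rule ccontr)
  assume "\<not> ?thesis"
  then have max: "(\<Sum>j<N. r j * k (u j + s)) \<le> (\<Sum>j<N. r j * k (u j))" for s
    by (simp add: not_less)
  obtain s where s: "s = 1 \<or> s = -1" and steep: "\<And>X. \<forall>\<^sub>F e in at_right 0. X \<le> (k (s * e) - k 0) / e"
    using infty_slope_at_zero[OF assms(1,2)] by blast
  have "\<exists>L. \<forall>\<^sub>F e in at_right 0. L \<le> (k (u j + s * e) - k (u j)) / e" if "j < N" for j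
    using steep[of 0] difference_quotient_bounded_below[OF _ _ s, of "u j"] u[OF that]
    by (cases "u j = 0") auto
  then obtain L where L: "\<And>j. j < N \<Longrightarrow> \<forall>\<^sub>F e in at_right 0. L j \<le> (k (u j + s * e) - k (u j)) / e"
    by metis
  \<comment> \<open>With this rate for summand \<open>i\<close> the weighted lower bounds add up to
    exactly 1, so the potential would rise by at least \<open>e\<close>.\<close>
  define X where "X = (1 - (\<Sum>j\<in>{..<N} - {i}. r j * L j)) / r i"
  define L' where "L' = L(i := X)"
  have "\<forall>j\<in>{..<N}. \<forall>\<^sub>F e in at_right 0. L' j \<le> (k (u j + s * e) - k (u j)) / e"
    using L steep i by (auto simp: L'_def)
  then have "\<forall>\<^sub>F e in at_right 0. \<forall>j\<in>{..<N}. L' j \<le> (k (u j + s * e) - k (u j)) / e"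
    by (rule eventually_ball_finite[OF finite_lessThan])
  moreover have "\<forall>\<^sub>F e in at_right 0. (0::real) < e"
    by (simp add: eventually_at_right_less)
  ultimately have "\<forall>\<^sub>F e in at_right (0::real). False"
  proof eventually_elim
    case (elim e)
    have "1 = r i * X + (\<Sum>j\<in>{..<N} - {i}. r j * L j)"
      using r[OF i(1)] by (simp add: X_def)
    also have "\<dots> = r i * L' i + (\<Sum>j\<in>{..<N} - {i}. r j * L' j)"
      by (simp add: L'_def)
    also have "\<dots> = (\<Sum>j<N. r j * L' j)"
      using i by (simp add: sum.remove[of _ i])
    also have "\<dots> \<le> (\<Sum>j<N. r j * ((k (u j + s * e) - k (u j)) / e))"
      using elim r by (intro sum_mono mult_left_mono) (auto simp: less_imp_le)
    also have "\<dots> = ((\<Sum>j<N. r j * k (u j + s * e)) - (\<Sum>j<N. r j * k (u j))) / e"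
      by (simp add: sum_subtractf[symmetric] sum_divide_distrib algebra_simps diff_divide_distrib)
    also have "\<dots> \<le> 0"
      using max[of "s * e"] elim by (simp add: divide_nonpos_pos)
    finally show False by simp
  qed
  then show False by simp
qed

lemma second_difference_tendsto_0:
  assumes "C1_kernel K" "0 < u" "u < 2*pi"
  shows "((\<lambda>e. (k (u + e) + k (u - e) - 2 * k u) / e) \<longlongrightarrow> 0) (at_right 0)"
proof -
  have "k differentiable (at u)"
    using assms unfolding C1_kernel_def Let_def by auto
  then obtain D where "DERIV k u :> D"
    using real_differentiable_def by blast
  then have lim: "((\<lambda>h. (k (u + h) - k u) / h) \<longlongrightarrow> D) (at 0)"
    by (simp add: DERIV_def)
  have "((\<lambda>h. (k (u + h) - k u) / h) \<longlongrightarrow> D) (at_right 0)"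
    using lim by (rule filterlim_mono) (auto intro: at_le)
  moreover have "((\<lambda>e. (k (u + (- e)) - k u) / (- e)) \<longlongrightarrow> D) (at_right 0)"
  proof (rule filterlim_compose[OF lim])
    show "filterlim uminus (at 0) (at_right (0::real))"
      unfolding filterlim_at
      by (auto intro!: tendsto_eq_intros simp: eventually_at_right_field intro: exI[of _ 1])
  qed
  ultimately have "((\<lambda>e. (k (u + e) - k u) / e - (k (u + (- e)) - k u) / (- e)) \<longlongrightarrow> D - D) (at_right 0)"
    by (rule tendsto_diff)
  moreover have "(\<lambda>e. (k (u + e) - k u) / e - (k (u + (- e)) - k u) / (- e)) =
      (\<lambda>e. (k (u + e) + k (u - e) - 2 * k u) / e)"
    by (simp add: fun_eq_iff add_divide_distrib diff_divide_distrib)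
  ultimately show ?thesis by simp
qed

text \<open>
  A smooth summand contributes o(e) to the symmetric second difference at step e, whereas a summand
  with its singularity at the point contributes at least a positive multiple of e.
\<close>
lemma no_max_at_singularity_C1:
  fixes N i :: nat
  assumes fin: "K 0 \<noteq> -\<infinity>" and C1: "C1_kernel K"
    and r: "\<And>j. j < N \<Longrightarrow> r j > 0"
    and u: "\<And>j. j < N \<Longrightarrow> 0 \<le> u j \<and> u j < 2*pi" and i: "i < N" "u i = 0"
  shows "\<exists>s. (\<Sum>j<N. r j * k (u j)) < (\<Sum>j<N. r j * k (u j + s))"
proof (rule ccontr)
  assume "\<not> ?thesis"
  then have max: "(\<Sum>j<N. r j * k (u j + s)) \<le> (\<Sum>j<N. r j * k (u j))" for s
    by (simp add: not_less)
  define D where "D j e = (k (u j + e) + k (u j - e) - 2 * k (u j)) / e" for j e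
  \<comment> \<open>This is the second difference quotient at 0 for the step \<open>pi\<close>,
    since \<open>k (- pi) = k pi\<close>; monotone slopes make it a lower bound for all shorter
    steps.\<close>
  define c where "c = 2 * ((k pi - k 0) / pi)"
  define g where "g j = (if u j = 0 then (\<lambda>e. c) else D j)" for j
  have "c > 0"
    using slope_strict[OF fin, of 0 pi "2*pi"] by (simp add: c_def divide_less_cancel)
  have g_le: "g j e \<le> D j e" if e: "0 < e" "e < pi" for j e
  proof (cases "u j = 0")
    case True
    have "(k pi - k 0) / pi \<le> (k e - k 0) / e"
      using slope_antimono(1)[OF fin, of 0 e pi] e by simp
    moreover have "(k (2*pi) - k (2*pi - e)) / e \<le> (k (2*pi) - k pi) / pi"
      using slope_antimono(2)[OF fin, of pi "2*pi - e" "2*pi"] e by simp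
    moreover have "K (2*pi - e) = K (- e)"
      using kernel_shift[of "-e"] by (simp add: algebra_simps)
    ultimately show ?thesis
      using True by (simp add: g_def D_def c_def add_divide_distrib diff_divide_distrib)
  qed (simp add: g_def)
  have "((\<lambda>e. \<Sum>j<N. r j * g j e) \<longlongrightarrow> (\<Sum>j<N. r j * (if u j = 0 then c else 0))) (at_right 0)"
  proof (intro tendsto_sum tendsto_mult_left)
    fix j assume "j \<in> {..<N}"
    then show "(g j \<longlongrightarrow> (if u j = 0 then c else 0)) (at_right 0)"
      using second_difference_tendsto_0[OF C1, of "u j"] u[of j] unfolding g_def D_def by auto
  qed
  moreover have "(\<Sum>j<N. r j * g j e) \<le> 0" if e: "0 < e" "e < pi" for e
  proof -
    have "(\<Sum>j<N. r j * g j e) \<le> (\<Sum>j<N. r j * D j e)"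
      using g_le[OF e] r by (intro sum_mono mult_left_mono) (auto simp: less_imp_le)
    also have "\<dots> = (((\<Sum>j<N. r j * k (u j + e)) - (\<Sum>j<N. r j * k (u j))) +
        ((\<Sum>j<N. r j * k (u j + (- e))) - (\<Sum>j<N. r j * k (u j)))) / e"
      unfolding D_def
      by (simp add: sum_subtractf[symmetric] sum.distrib[symmetric] sum_divide_distrib algebra_simps diff_divide_distrib)
    also have "\<dots> \<le> 0"
      using max[of e] max[of "- e"] e by (intro divide_nonpos_pos) auto
    finally show ?thesis .
  qed
  then have "\<forall>\<^sub>F e in at_right 0. (\<Sum>j<N. r j * g j e) \<le> 0"
    by (auto simp: eventually_at_right_field intro!: exI[of _ pi])
  ultimately have "(\<Sum>j<N. r j * (if u j = 0 then c else 0)) \<le> 0"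
    by (intro tendsto_upperbound) auto
  moreover have "0 < (\<Sum>j<N. r j * (if u j = 0 then c else 0))"
    using r i \<open>c > 0\<close> by (intro sum_pos2[of _ i]) (auto simp: less_imp_le)
  ultimately show False by simp
qed

section \<open>Potentials with values in [-infinity, infinity)\<close>

definition pot :: "nat \<Rightarrow> (nat \<Rightarrow> real) \<Rightarrow> (nat \<Rightarrow> real) \<Rightarrow> real \<Rightarrow> ereal" where
  "pot N r z t = (\<Sum>j<N. ereal (r j) * K (t - z j))"

lemma pot_not_PInf:
  assumes "\<And>j. j < N \<Longrightarrow> r j > 0"
  shows "pot N r z t \<noteq> \<infinity>"
  using assms kernel_not_PInf by (fastforce simp: pot_def sum_Pinfty ereal_mult_eq_PInfty)

lemma pot_MInf_iff:
  assumes "\<And>j. j < N \<Longrightarrow> r j > 0"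
  shows "pot N r z t = -\<infinity> \<longleftrightarrow> (\<exists>j<N. K (t - z j) = -\<infinity>)"
  using assms
proof (induction N)
  case (Suc N)
  have "pot (Suc N) r z t = pot N r z t + ereal (r N) * K (t - z N)"
    by (simp add: pot_def)
  moreover have "pot N r z t \<noteq> \<infinity>"
    using Suc.prems by (intro pot_not_PInf) auto
  moreover have "ereal (r N) * K (t - z N) \<noteq> \<infinity>" "ereal (r N) * K (t - z N) = -\<infinity> \<longleftrightarrow> K (t - z N) = -\<infinity>"
    using Suc.prems[of N] kernel_not_PInf[of "t - z N"] by (cases "K (t - z N)"; simp)+
  ultimately show ?case
    using Suc by (auto simp: less_Suc_eq ereal_plus_eq_MInfty)
qed (simp add: pot_def)

lemma pot_real:
  assumes "\<And>j. j < N \<Longrightarrow> \<bar>K (t - z j)\<bar> \<noteq> \<infinity>"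
  shows "pot N r z t = ereal (\<Sum>j<N. r j * k (t - z j))"
proof -
  have "pot N r z t = (\<Sum>j<N. ereal (r j * k (t - z j)))"
    unfolding pot_def using assms by (intro sum.cong) (auto simp: ereal_real' simp flip: times_ereal.simps(1))
  then show ?thesis by simp
qed

text \<open>Each summand can be -infinity only on a translate of the multiples of
  \<open>2*pi\<close>, so only countably many points are lost.\<close>

lemma exists_pot_finite:
  assumes "\<And>j. j < N \<Longrightarrow> r j > 0"
  shows "\<exists>t. pot N r z t \<noteq> -\<infinity>"
proof -
  define B where "B = (\<Union>j<N. range (\<lambda>m::int. z j + of_int m * (2*pi)))"
  have "countable B"
    unfolding B_def by (intro countable_UN) auto
  then obtain t where t: "t \<notin> B"
    using uncountable_UNIV_real by (metis UNIV_eq_I)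
  have "K (t - z j) \<noteq> -\<infinity>" if "j < N" for j
  proof -
    obtain m u where u: "t - z j = u + of_int m * (2*pi)" "0 \<le> u" "u < 2*pi"
      by (rule reduce_mod_2pi)
    have "u \<noteq> 0"
    proof
      assume "u = 0"
      then have "t = z j + of_int m * (2*pi)" using u by simp
      then show False using t that unfolding B_def by blast
    qed
    then have "\<bar>K u\<bar> \<noteq> \<infinity>" using u kernel_finite[of u] by simp
    then show ?thesis using u kernel_shift_int[of u m] by auto
  qed
  then show ?thesis
    using pot_MInf_iff[where r=r, OF assms] by blast
qed

text \<open>Reducing the differences to one period puts node \<open>i\<close> at the singularity.
  Other nodes may coincide with it (\<open>u j = 0\<close> with \<open>j \<noteq> i\<close>), which
  is what collapsed gaps require.\<close>

lemma node_not_max: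
  assumes cond: "cond_infty' K \<or> C1_kernel K"
    and r: "\<And>j. j < N \<Longrightarrow> r j > 0" and i: "i < N"
  shows "\<exists>t. pot N r z (z i) < pot N r z t"
proof (cases "K 0 = -\<infinity>")
  case True
  then have "pot N r z (z i) = -\<infinity>"
    using pot_MInf_iff[where r=r, OF r] i by fastforce
  then show ?thesis
    using exists_pot_finite[where r=r, OF r] by (metis ereal_infty_less(2))
next
  case False
  have "\<exists>u. 0 \<le> u \<and> u < 2*pi \<and> (\<exists>m::int. z i - z j = u + of_int m * (2*pi)) \<and> (j = i \<longrightarrow> u = 0)" for j
  proof (cases "j = i")
    case True
    then show ?thesis by (intro exI[of _ 0]) (auto intro: exI[of _ 0])
  next
    case False
    then show ?thesis using reduce_mod_2pi[of "z i - z j"] by metis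
  qed
  then obtain u where u: "\<And>j. 0 \<le> u j \<and> u j < 2*pi" "u i = 0"
    and shift: "\<And>j. \<exists>m::int. z i - z j = u j + of_int m * (2*pi)"
    by metis
  have k_eq: "k (z i + s - z j) = k (u j + s)" for s j
  proof -
    obtain m :: int where "z i - z j = u j + of_int m * (2*pi)"
      using shift by blast
    then have "z i + s - z j = (u j + s) + of_int m * (2*pi)" by simp
    then show ?thesis by (simp only: kernel_shift_int)
  qed
  obtain s where "(\<Sum>j<N. r j * k (u j)) < (\<Sum>j<N. r j * k (u j + s))"
    using cond no_max_at_singularity_infty[OF False, of N r u i] no_max_at_singularity_C1[OF False, of N r u i] r u i
    by blast
  then have "pot N r z (z i) < pot N r z (z i + s)"
    using k_eq[of 0] k_eq[of s] by (simp add: pot_real kernel_finite_everywhere[OF False])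
  then show ?thesis by blast
qed

end

section \<open>Cyclic configurations of nodes\<close>

locale cyclic_kernel = strict_kernel +
  fixes N :: nat
  assumes N_pos: "0 < N" and regular: "cond_infty' K \<or> C1_kernel K"
begin

definition weights :: "(nat \<Rightarrow> real) \<Rightarrow> bool" where
  "weights r \<longleftrightarrow> (\<forall>j. r j > 0 \<and> r (j + N) = r j)"

text \<open>Weak inequalities admit coinciding nodes and make the set closed. The base point
  \<open>z 0\<close> is left free, so that it can move.\<close>

definition config :: "(nat \<Rightarrow> real) \<Rightarrow> bool" where
  "config z \<longleftrightarrow> (\<forall>j. z j \<le> z (Suc j) \<and> z (j + N) = z j + 2*pi)"

definition gapmax :: "(nat \<Rightarrow> real) \<Rightarrow> (nat \<Rightarrow> real) \<Rightarrow> nat \<Rightarrow> ereal" where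
  "gapmax r z j = (SUP t\<in>{z j..z (Suc j)}. pot N r z t)"

definition topmax :: "(nat \<Rightarrow> real) \<Rightarrow> (nat \<Rightarrow> real) \<Rightarrow> ereal" where
  "topmax r z = (SUP t. pot N r z t)"

abbreviation rot :: "nat \<Rightarrow> (nat \<Rightarrow> real) \<Rightarrow> nat \<Rightarrow> real" where
  "rot i z \<equiv> (\<lambda>j. z (j + i))"

lemma weights_pos: "weights r \<Longrightarrow> r j > 0"
  by (simp add: weights_def)

lemma weights_rot: "weights r \<Longrightarrow> weights (rot i r)"
  unfolding weights_def by (metis add.assoc add.commute)

lemma weights_mult: "weights r \<Longrightarrow> r (j + m * N) = r j"
proof (induction m)
  case (Suc m)
  have "r (j + Suc m * N) = r ((j + m * N) + N)" by (simp add: algebra_simps)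
  then show ?case using Suc unfolding weights_def by metis
qed simp

lemma config_Suc: "config z \<Longrightarrow> z j \<le> z (Suc j)"
  by (simp add: config_def)

lemma config_period: "config z \<Longrightarrow> z (j + N) = z j + 2*pi"
  by (simp add: config_def)

lemma config_mono: "config z \<Longrightarrow> i \<le> j \<Longrightarrow> z i \<le> z j"
  by (rule lift_Suc_mono_le[of z]) (simp_all add: config_Suc)

lemma quasi_period_mult:
  fixes z :: "nat \<Rightarrow> real"
  assumes "\<And>j. z (j + N) = z j + c"
  shows "z (j + m * N) = z j + real m * c"
proof (induction m)
  case (Suc m)
  have "z (j + Suc m * N) = z ((j + m * N) + N)" by (simp add: algebra_simps)
  also have "\<dots> = z j + real m * c + c" unfolding assms Suc ..
  finally show ?case by (simp add: algebra_simps)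
qed simp

lemma config_mult: "config z \<Longrightarrow> z (j + m * N) = z j + real m * (2*pi)"
  by (intro quasi_period_mult config_period)

lemma configI:
  assumes per: "\<And>j. z (j + N) = z j + 2*pi" and le: "\<And>j. j < N \<Longrightarrow> z j \<le> z (Suc j)"
  shows "config z"
proof -
  note mult = quasi_period_mult[of z "2*pi", OF per]
  have "z j \<le> z (Suc j)" for j
  proof -
    have "z (j mod N) \<le> z (Suc (j mod N))"
      using N_pos by (intro le) simp
    then have "z (j mod N + (j div N) * N) \<le> z (Suc (j mod N) + (j div N) * N)"
      unfolding mult by simp
    then show ?thesis by simp
  qed
  then show ?thesis using per by (simp add: config_def)
qed

lemma config_rot: "config z \<Longrightarrow> config (rot i z)"
  by (simp add: config_def add.assoc add.commute[of N]) (metis add.assoc)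

lemma config_translate: "config z \<Longrightarrow> config (\<lambda>j. z j + c)"
  by (simp add: config_def)

lemma sum_rot:
  fixes g :: "nat \<Rightarrow> ereal"
  assumes "\<And>j. g (j + N) = g j"
  shows "(\<Sum>j<N. g (j + i)) = (\<Sum>j<N. g j)"
proof (induction i)
  case (Suc i)
  obtain n where n: "N = Suc n" using N_pos gr0_implies_Suc by blast
  have "(\<Sum>j<N. g (j + Suc i)) = (\<Sum>j<n. g (Suc j + i)) + g (i + N)"
    unfolding n by (simp add: add.commute)
  also have "\<dots> = (\<Sum>j<N. g (j + i))"
    unfolding assms unfolding n by (simp only: sum.lessThan_Suc_shift) (simp add: add.commute)
  finally show ?case using Suc by simp
qed simp

lemma pot_shift: "pot N r z (t + of_int m * (2*pi)) = pot N r z t"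
proof -
  have "K (t + of_int m * (2*pi) - z j) = K (t - z j)" for j
    using kernel_shift_int[of "t - z j" m] by (simp add: algebra_simps)
  then show ?thesis unfolding pot_def by simp
qed

lemma pot_rot:
  assumes "weights r" "config z"
  shows "pot N (rot i r) (rot i z) t = pot N r z t"
proof -
  have "K (t - (z j + 2*pi)) = K (t - z j)" for j
    using kernel_shift[of "t - (z j + 2*pi)"] by simp
  then show ?thesis
    using assms sum_rot[of "\<lambda>j. ereal (r j) * K (t - z j)" i]
    unfolding pot_def by (simp add: weights_def config_period)
qed

lemma gapmax_rot:
  "weights r \<Longrightarrow> config z \<Longrightarrow> gapmax (rot i r) (rot i z) j = gapmax r z (j + i)"
  by (simp add: gapmax_def pot_rot)

lemma topmax_rot:
  "weights r \<Longrightarrow> config z \<Longrightarrow> topmax (rot i r) (rot i z) = topmax r z"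
  by (simp add: topmax_def pot_rot)

lemma pot_translate: "pot N r (\<lambda>j. z j + c) (t + c) = pot N r z t"
  by (simp add: pot_def)

lemma gapmax_translate: "gapmax r (\<lambda>j. z j + c) j = gapmax r z j"
proof -
  have "{z j + c..z (Suc j) + c} = (\<lambda>t. t + c) ` {z j..z (Suc j)}"
    by simp
  then show ?thesis
    unfolding gapmax_def by (simp only: image_image pot_translate)
qed

lemma topmax_translate: "topmax r (\<lambda>j. z j + c) = topmax r z"
proof -
  have "(SUP t. pot N r (\<lambda>j. z j + c) t) = (SUP t. pot N r (\<lambda>j. z j + c) (t + c))"
    by (rule SUP_eq) (auto intro: exI[of _ "_ - c"])
  then show ?thesis
    unfolding topmax_def pot_translate .
qed

lemma gapmax_mult:
  assumes "config z"
  shows "gapmax r z (j + m * N) = gapmax r z j"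
proof -
  have "z (Suc (j + m * N)) = z (Suc j) + real m * (2*pi)"
    using config_mult[OF assms, of "Suc j" m] by simp
  then have "{z (j + m * N)..z (Suc (j + m * N))} = (\<lambda>t. t + of_int (int m) * (2*pi)) ` {z j..z (Suc j)}"
    using config_mult[OF assms, of j m] by simp
  then show ?thesis
    unfolding gapmax_def by (simp only: image_image pot_shift)
qed

text \<open>Naturals admit no rotation by \<open>- i\<close>. Rotation by \<open>i * N - i\<close>
  replaces it: followed by \<open>i\<close> it makes \<open>i\<close> full turns, which neither the
  weights nor the gap maxima notice.\<close>

lemma unrotate:
  assumes "weights r" "config z"
  obtains z' where "config z'" "topmax r z' = topmax (rot i r) z"
    "\<And>j. gapmax r z' (j + i) = gapmax (rot i r) z j"
proof
  define p where "p = i * N - i"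
  have "i * N = i + p" using N_pos by (simp add: p_def)
  then have p: "j + i + p = j + i * N" "j + p + i = j + i * N" for j
    by simp_all
  have "rot p (rot i r) = r"
    using weights_mult[OF assms(1), of _ i] by (simp add: p)
  then show "config (rot p z)" "topmax r (rot p z) = topmax (rot i r) z"
    "gapmax r (rot p z) (j + i) = gapmax (rot i r) z j" for j
    using config_rot[OF assms(2), of p] topmax_rot[OF weights_rot[OF assms(1), of i] assms(2), of p]
      gapmax_rot[OF weights_rot[OF assms(1), of i] assms(2), of p "j + i"] gapmax_mult[OF assms(2), of "rot i r" j i]
    by (simp_all only: p)
qed

section \<open>Continuity of the potential and attained maxima\<close>

lemma tendsto_pot:
  assumes "weights r" and z: "\<And>j. j < N \<Longrightarrow> ((\<lambda>e. w e j) \<longlongrightarrow> z j) G" and t: "(u \<longlongrightarrow> t) G"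
  shows "((\<lambda>e. pot N r (w e) (u e)) \<longlongrightarrow> pot N r z t) G"
proof -
  \<comment> \<open>Induction on partial sums: addition in \<open>ereal\<close> is continuous except
    at sums of opposite infinities, and neither limit here is +infinity.\<close>
  have "((\<lambda>e. pot M r (w e) (u e)) \<longlongrightarrow> pot M r z t) G" if "M \<le> N" for M
    using that
  proof (induction M)
    case (Suc M)
    have "((\<lambda>e. K (u e - w e M)) \<longlongrightarrow> K (t - z M)) G"
      by (rule isCont_tendsto_compose[OF isCont_kernel]) (use Suc.prems in \<open>auto intro!: tendsto_diff z t\<close>)
    then have "((\<lambda>e. ereal (r M) * K (u e - w e M)) \<longlongrightarrow> ereal (r M) * K (t - z M)) G"
      by (intro tendsto_cmult_ereal) auto
    moreover have "pot M r z t \<noteq> \<infinity>"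
      using assms(1) by (intro pot_not_PInf) (auto simp: weights_def)
    moreover have "ereal (r M) * K (t - z M) \<noteq> \<infinity>"
      using weights_pos[OF assms(1), of M] kernel_not_PInf[of "t - z M"] by (cases "K (t - z M)") auto
    ultimately have "((\<lambda>e. pot M r (w e) (u e) + ereal (r M) * K (u e - w e M)) \<longlongrightarrow>
        pot M r z t + ereal (r M) * K (t - z M)) G"
      using Suc by (intro tendsto_add_ereal_general) auto
    then show ?case by (simp add: pot_def)
  qed (simp add: pot_def)
  then show ?thesis by blast
qed

lemma continuous_on_pot: "weights r \<Longrightarrow> continuous_on S (pot N r z)"
  unfolding continuous_on_def by (auto intro!: tendsto_pot tendsto_const tendsto_ident_at)

lemma gapmax_attained:
  assumes "weights r" "config z"
  obtains t where "z j \<le> t" "t \<le> z (Suc j)" "gapmax r z j = pot N r z t"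
proof -
  obtain t where t: "t \<in> {z j..z (Suc j)}" "\<And>s. s \<in> {z j..z (Suc j)} \<Longrightarrow> pot N r z s \<le> pot N r z t"
    using continuous_attains_sup[OF compact_Icc _ continuous_on_pot[OF assms(1)], of "z j" "z (Suc j)" z]
      config_Suc[OF assms(2), of j] by (metis atLeastatMost_empty_iff2 linorder_not_le order_less_irrefl order_le_less_trans)
  then have "gapmax r z j = pot N r z t"
    unfolding gapmax_def by (intro antisym SUP_least SUP_upper) auto
  then show thesis using that t by auto
qed

lemma pot_le_gapmax: "z j \<le> t \<Longrightarrow> t \<le> z (Suc j) \<Longrightarrow> pot N r z t \<le> gapmax r z j"
  unfolding gapmax_def by (intro SUP_upper) auto

lemma pot_le_topmax: "pot N r z t \<le> topmax r z"
  unfolding topmax_def by (intro SUP_upper) auto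

lemma gapmax_le_topmax: "gapmax r z j \<le> topmax r z"
  unfolding gapmax_def by (intro SUP_least pot_le_topmax)

lemma reduce_to_window:
  obtains s where "a \<le> s" "s < a + 2*pi" "\<And>r z. pot N r z t = pot N r z s"
proof -
  obtain m u where u: "t - a = u + of_int m * (2*pi)" "0 \<le> u" "u < 2*pi"
    by (rule reduce_mod_2pi)
  then have "t = (a + u) + of_int m * (2*pi)" by simp
  then have "pot N r z t = pot N r z (a + u)" for r z
    by (simp only: pot_shift)
  then show thesis using that[of "a + u"] u by auto
qed

lemma topmax_attained:
  assumes "weights r"
  obtains t where "topmax r z = pot N r z t"
proof -
  obtain t where t: "\<And>s. s \<in> {0..2*pi} \<Longrightarrow> pot N r z s \<le> pot N r z t"
    using continuous_attains_sup[OF compact_Icc _ continuous_on_pot[OF assms(1)], of 0 "2*pi" z] by force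
  have "pot N r z s \<le> pot N r z t" for s
  proof -
    obtain s' where "0 \<le> s'" "s' < 0 + 2*pi" "pot N r z s = pot N r z s'"
      using reduce_to_window[of 0 s] by metis
    then show ?thesis using t[of s'] by simp
  qed
  then have "topmax r z = pot N r z t"
    unfolding topmax_def by (intro antisym SUP_least SUP_upper) auto
  then show thesis using that by blast
qed

lemma topmax_not_MInf: "weights r \<Longrightarrow> topmax r z \<noteq> -\<infinity>"
  using exists_pot_finite[of N r z] pot_le_topmax[of r z] by (metis ereal_infty_less_eq(2) weights_pos)

lemma gap_containing:
  assumes "config z"
  obtains j s where "j < N" "z j \<le> s" "s \<le> z (Suc j)" "\<And>r. pot N r z t = pot N r z s"
proof -
  obtain s where s: "z 0 \<le> s" "s < z 0 + 2*pi" "\<And>r. pot N r z t = pot N r z s"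
    using reduce_to_window[of "z 0" t] by metis
  have "s < z N" using config_period[OF assms, of 0] s by simp
  define p where "p = (LEAST p. s < z p)"
  have p: "s < z p" "p \<le> N"
    unfolding p_def using \<open>s < z N\<close> by (auto intro: LeastI Least_le)
  then have "p \<noteq> 0" using s by (metis linorder_not_le)
  then obtain j where j: "p = Suc j" using not0_implies_Suc by blast
  have "\<not> s < z j" using not_less_Least[of j "\<lambda>p. s < z p"] j unfolding p_def by simp
  then show thesis using that[of j s] p s j by auto
qed

lemma topmax_eq_gapmax:
  assumes "weights r" "config z"
  obtains j where "j < N" "topmax r z = gapmax r z j"
proof -
  obtain t where t: "topmax r z = pot N r z t"
    using topmax_attained[OF assms(1)] by blast
  obtain j s where j: "j < N" "z j \<le> s" "s \<le> z (Suc j)" "pot N r z t = pot N r z s"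
    using gap_containing[OF assms(2), of t] by metis
  have "topmax r z = gapmax r z j"
    using t j pot_le_gapmax[of z j s r] gapmax_le_topmax[of r z j] by auto
  then show thesis using that j by blast
qed

text \<open>Rotation by \<open>j\<close> makes the node the first one, so \<open>j\<close> may be
  any index, also beyond \<open>N\<close>.\<close>

lemma node_lt_topmax:
  assumes "weights r" "config z"
  shows "pot N r z (z j) < topmax r z"
proof -
  obtain t where "pot N (rot j r) (rot j z) (rot j z 0) < pot N (rot j r) (rot j z) t"
    using node_not_max[OF regular, of N "rot j r" 0 "rot j z"] assms N_pos by (auto simp: weights_pos)
  then show ?thesis
    using assms pot_le_topmax[of r z t] by (simp add: pot_rot)
qed

text \<open>Adding the common summands keeps the inequality strict unless their sum is -infinity;
  the first alternative records that case.\<close>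

lemma pot_pair_less:
  assumes r: "weights r" and l: "0 < l" "l < N"
    and eq: "\<And>j. j < N \<Longrightarrow> j \<noteq> 0 \<Longrightarrow> j \<noteq> l \<Longrightarrow> z' j = z j"
    and less: "ereal (r 0) * K (t - z' 0) + ereal (r l) * K (t - z' l)
      < ereal (r 0) * K (t - z 0) + ereal (r l) * K (t - z l)"
  shows "pot N r z' t = -\<infinity> \<or> pot N r z' t < pot N r z t"
proof -
  define A where "A = {..<N} - {0, l}"
  have N: "{..<N} = insert 0 (insert l A)" "finite A" "0 \<notin> insert l A" "l \<notin> A"
    using l by (auto simp: A_def)
  have split: "pot N r y t = (\<Sum>j\<in>A. ereal (r j) * K (t - y j)) +
      (ereal (r 0) * K (t - y 0) + ereal (r l) * K (t - y l))" for y
    unfolding pot_def N(1) using N(2-) by (simp add: ac_simps)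
  have rest: "(\<Sum>j\<in>A. ereal (r j) * K (t - z' j)) = (\<Sum>j\<in>A. ereal (r j) * K (t - z j))" (is "_ = ?R")
    by (intro sum.cong) (auto simp: A_def eq)
  have "ereal (r j) * K s \<noteq> \<infinity>" for j s
    using weights_pos[OF r, of j] kernel_not_PInf[of s] by (cases "K s") auto
  then have "?R \<noteq> \<infinity>"
    by (auto simp: sum_Pinfty)
  moreover have "ereal (r 0) * K (t - z' 0) + ereal (r l) * K (t - z' l) \<noteq> \<infinity>"
    using less by auto
  ultimately show ?thesis
    unfolding split rest using less
    by (cases ?R) (auto simp: ereal_plus_eq_MInfty ereal_less_add)
qed

section \<open>Moving two nodes\<close>

text \<open>
  Several consecutive nodes may coincide, so the pair moved apart consists of the extreme nodes 0
  and l of such a block; l = 1 is the case of an ordinary gap.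
\<close>
lemma spread_nodes_lowers_topmax:
  assumes r: "weights r" and z: "config z" and l: "0 < l" "l < N"
    and gap: "z (N - 1) < z N" "z l < z (Suc l)"
    and low: "\<And>t. z 0 \<le> t \<Longrightarrow> t \<le> z l \<Longrightarrow> pot N r z t < topmax r z"
  shows "\<exists>z'. config z' \<and> topmax r z' < topmax r z"
proof -
  define B where "B = topmax r z"
  \<comment> \<open>Velocities inverse to the weights, to the left for node 0 and to the right for
    node \<open>l\<close>, fix the weighted centre; \<open>mod\<close> repeats the motion in every
    period.\<close>
  define v where "v j = (if j mod N = 0 then - 1 / r 0 else if j mod N = l then 1 / r l else 0)" for j
  define Z where "Z h j = z j + h * v j" for h j
  have r0: "r 0 > 0" "r l > 0" using r by (auto simp: weights_pos)
  have Z0: "Z h 0 = z 0 - h / r 0" and Zl: "Z h l = z l + h / r l" for h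
    using l by (auto simp: Z_def v_def)
  \<comment> \<open>Between the moving nodes the potential may rise. If it reached \<open>B\<close>
    for arbitrarily small \<open>h\<close>, the points where it does so would accumulate at a point
    of the original arc, against \<open>low\<close>.\<close>
  have "\<exists>H>0. \<forall>h t. 0 < h \<and> h < H \<and> Z h 0 \<le> t \<and> t \<le> Z h l \<longrightarrow> pot N r (Z h) t < B"
  proof (rule ccontr)
    assume contra: "\<not> ?thesis"
    have "\<exists>h t. 0 < h \<and> h < inverse (real (Suc n)) \<and> Z h 0 \<le> t \<and> t \<le> Z h l \<and> B \<le> pot N r (Z h) t" for n
      using contra by (metis inverse_positive_iff_positive linorder_not_less of_nat_0_less_iff zero_less_Suc)
    then obtain h t where ht: "\<And>n::nat. 0 < h n \<and> h n < inverse (real (Suc n)) \<and> Z (h n) 0 \<le> t n \<and> t n \<le> Z (h n) l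
        \<and> B \<le> pot N r (Z (h n)) (t n)"
      by metis
    have h0: "h \<longlonglongrightarrow> 0"
      by (rule real_tendsto_sandwich[OF _ _ tendsto_const LIMSEQ_inverse_real_of_nat])
        (use ht in \<open>auto intro!: always_eventually less_imp_le\<close>)
    have "t n \<in> {z 0 - 1 / r 0..z l + 1 / r l}" for n
    proof -
      have "inverse (real (Suc n)) \<le> 1" by (simp add: inverse_le_1_iff)
      then have "h n \<le> 1" using ht[of n] by linarith
      then have "h n / r 0 \<le> 1 / r 0" "h n / r l \<le> 1 / r l"
        using r0 by (auto intro!: divide_right_mono)
      then show ?thesis using ht[of n] unfolding Z0 Zl by auto
    qed
    then obtain s \<phi> where \<phi>: "strict_mono \<phi>" and s: "(t \<circ> \<phi>) \<longlonglongrightarrow> s"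
      using compact_Icc[of "z 0 - 1 / r 0" "z l + 1 / r l"] unfolding compact_def by metis
    have h\<phi>: "(\<lambda>n. h (\<phi> n)) \<longlonglongrightarrow> 0"
      using LIMSEQ_subseq_LIMSEQ[OF h0 \<phi>] by (simp add: o_def)
    have ZL: "(\<lambda>n. Z (h (\<phi> n)) j) \<longlonglongrightarrow> z j" for j
      using tendsto_add[OF tendsto_const[of "z j"] tendsto_mult_right[OF h\<phi>, of "v j"]] by (simp add: Z_def)
    have sL: "(\<lambda>n. t (\<phi> n)) \<longlonglongrightarrow> s" using s by (simp add: o_def)
    have "z 0 \<le> s" by (rule LIMSEQ_le[OF ZL sL]) (use ht in blast)
    moreover have "s \<le> z l" by (rule LIMSEQ_le[OF sL ZL]) (use ht in blast)
    moreover have "B \<le> pot N r z s"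
      by (rule tendsto_lowerbound[OF tendsto_pot[OF r ZL sL]]) (use ht in auto)
    ultimately show False using low[of s] by (simp add: B_def)
  qed
  then obtain H where H: "H > 0" "\<And>h t. 0 < h \<Longrightarrow> h < H \<Longrightarrow> Z h 0 \<le> t \<Longrightarrow> t \<le> Z h l \<Longrightarrow> pot N r (Z h) t < B"
    by blast
  define g where "g = min (z N - z (N - 1)) (z (Suc l) - z l)"
  have "g > 0" using gap by (simp add: g_def)
  \<comment> \<open>For \<open>l = N - 1\<close> the two outer gaps are one and the same, shrinking
    from both ends; therefore the sum of both displacements has to fit into
    \<open>g\<close>.\<close>
  define h where "h = min (H / 2) (g / (1 / r 0 + 1 / r l))"
  have rr: "0 < 1 / r 0 + 1 / r l" using r0 by (simp add: add_pos_pos)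
  have h: "0 < h" "h < H"
    using H(1) \<open>g > 0\<close> rr by (auto simp: h_def)
  have "h * (1 / r 0 + 1 / r l) \<le> g"
    using rr by (simp add: h_def min_le_iff_disj pos_le_divide_eq[symmetric])
  then have hg: "h / r 0 + h / r l \<le> g" by (simp add: algebra_simps)
  have hpos: "0 < h / r 0" "0 < h / r l" using h r0 by auto
  have conf: "config (Z h)"
  proof (rule configI)
    show "Z h (j + N) = Z h j + 2*pi" for j
      by (simp add: Z_def v_def config_period[OF z])
    fix j assume j: "j < N"
    have m: "Suc j mod N = (if Suc j = N then 0 else Suc j)" using j by auto
    have zj: "z j \<le> z (Suc j)" using z by (rule config_Suc)
    show "Z h j \<le> Z h (Suc j)"
    proof (cases "Suc j = N")
      case True
      then have "z (Suc j) - z j \<ge> g" by (auto simp: g_def)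
      then show ?thesis using True j m hg hpos l unfolding Z_def v_def by auto
    next
      case False
      show ?thesis
      proof (cases "j = l")
        case True
        then have "z (Suc j) - z j \<ge> g" by (auto simp: g_def)
        then show ?thesis using True False j m hg hpos l unfolding Z_def v_def by auto
      next
        case False
        then show ?thesis using \<open>Suc j \<noteq> N\<close> j m hpos zj unfolding Z_def v_def by auto
      qed
    qed
  qed
  have Bfin: "B \<noteq> -\<infinity>" unfolding B_def by (rule topmax_not_MInf[OF r])
  have "pot N r (Z h) t < B" for t
  proof -
    obtain s where s: "Z h 0 \<le> s" "s < Z h 0 + 2*pi" "pot N r (Z h) t = pot N r (Z h) s"
      using reduce_to_window[of "Z h 0" t] by metis
    show ?thesis
    proof (cases "s \<le> Z h l")
      case True
      then show ?thesis using H(2)[OF h] s by simp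
    next
      case False
      have "ereal (r 0) * K (s - Z h 0) + ereal (r l) * K (s - Z h l)
          < ereal (r 0) * K (s - z 0) + ereal (r l) * K (s - z l)"
        by (rule kernel_spread) (use False s hpos r0 config_mono[OF z, of 0 l] in \<open>auto simp: Z0 Zl\<close>)
      moreover have "Z h j = z j" if "j < N" "j \<noteq> 0" "j \<noteq> l" for j
        using that by (simp add: Z_def v_def)
      ultimately have "pot N r (Z h) s = -\<infinity> \<or> pot N r (Z h) s < pot N r z s"
        by (intro pot_pair_less[OF r l]) auto
      then show ?thesis
        using Bfin pot_le_topmax[of r z s] s by (auto simp: B_def)
    qed
  qed
  moreover obtain t where "topmax r (Z h) = pot N r (Z h) t"
    using topmax_attained[OF r] by blast
  ultimately have "topmax r (Z h) < topmax r z" by (simp add: B_def)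
  then show ?thesis using conf by blast
qed

text \<open>The reverse of spreading: off the arc between the two nodes every finite value of the
  potential rises. Every other gap contains its former self, so its old maximum point remains
  available. The contracted gap only has to stay above \<open>B\<close>, which continuity grants for
  small \<open>h\<close>.\<close>

lemma contract_gap_raises_others:
  assumes r: "weights r" and z: "config z" and N: "1 < N" and gap: "z 0 < z 1"
    and B: "B \<noteq> -\<infinity>" "\<And>j. B \<le> gapmax r z j" "B < gapmax r z 0"
  shows "\<exists>z'. config z' \<and> (\<forall>j<N. B < gapmax r z' j)"
proof -
  define v where "v j = (if j mod N = 0 then 1 / r 0 else if j mod N = 1 then - 1 / r 1 else 0)" for j
  define Z where "Z h j = z j + h * v j" for h j
  have r0: "r 0 > 0" "r 1 > 0" using r by (auto simp: weights_pos)
  have Z0: "Z h 0 = z 0 + h / r 0" and Z1: "Z h 1 = z 1 - h / r 1" and ZN: "Z h N = z N + h / r 0" for h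
    using N by (auto simp: Z_def v_def)
  obtain t0 where t0: "z 0 \<le> t0" "t0 \<le> z 1" "gapmax r z 0 = pot N r z t0"
    using gapmax_attained[OF r z, of 0] by auto
  \<comment> \<open>\<open>t0\<close> is clamped to the shrinking gap, so \<open>T h\<close> tends
    to \<open>t0\<close> even if \<open>t0\<close> is an end point.\<close>
  define T where "T h = max (Z h 0) (min (Z h 1) t0)" for h
  have ZL: "((\<lambda>h. Z h j) \<longlongrightarrow> z j) (at_right 0)" for j
  proof -
    have "((\<lambda>h. z j + h * v j) \<longlongrightarrow> z j + 0 * v j) (at_right 0)"
      by (intro tendsto_intros)
    then show ?thesis by (simp add: Z_def)
  qed
  have "(T \<longlongrightarrow> max (z 0) (min (z 1) t0)) (at_right 0)"
    unfolding T_def by (intro tendsto_intros ZL)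
  then have "(T \<longlongrightarrow> t0) (at_right 0)"
    using t0 by (simp add: max_def min_def split: if_splits)
  then have "((\<lambda>h. pot N r (Z h) (T h)) \<longlongrightarrow> pot N r z t0) (at_right 0)"
    by (intro tendsto_pot[OF r ZL])
  then have "\<forall>\<^sub>F h in at_right 0. B < pot N r (Z h) (T h)"
    using B(3) t0(3) by (intro order_tendstoD(1)) simp_all
  moreover have "\<forall>\<^sub>F h in at_right 0. Z h 0 < Z h 1"
  proof -
    have "((\<lambda>h. Z h 1 - Z h 0) \<longlongrightarrow> z 1 - z 0) (at_right 0)"
      by (intro tendsto_diff ZL)
    moreover have "0 < z 1 - z 0" using gap by (simp only: diff_gt_0_iff_gt)
    ultimately have "\<forall>\<^sub>F h in at_right 0. 0 < Z h 1 - Z h 0"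
      by (rule order_tendstoD(1))
    then show ?thesis by eventually_elim simp
  qed
  moreover have "\<forall>\<^sub>F h in at_right (0::real). 0 < h"
    by (simp add: eventually_at_right_less)
  ultimately have "\<forall>\<^sub>F h in at_right 0. B < pot N r (Z h) (T h) \<and> Z h 0 < Z h 1 \<and> 0 < h"
    by eventually_elim simp
  then obtain h where h: "B < pot N r (Z h) (T h)" "Z h 0 < Z h 1" "0 < h"
    using eventually_happens'[OF trivial_limit_at_right_real] by blast
  have hpos: "0 < h / r 0" "0 < h / r 1" using h r0 by auto
  have inner: "Z h j \<le> z j" "z (Suc j) \<le> Z h (Suc j)" if "0 < j" "j < N" for j
    using that hpos by (auto simp: Z_def v_def mod_Suc)
  have conf: "config (Z h)"
  proof (rule configI)
    show "Z h (j + N) = Z h j + 2*pi" for j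
      by (simp add: Z_def v_def config_period[OF z])
    fix j assume "j < N"
    then show "Z h j \<le> Z h (Suc j)"
      using h(2) inner[of j] config_Suc[OF z, of j] by (cases "j = 0") auto
  qed
  have "B < gapmax r (Z h) j" if j: "j < N" for j
  proof (cases "j = 0")
    case True
    have "pot N r (Z h) (T h) \<le> gapmax r (Z h) 0"
      by (rule pot_le_gapmax) (use h(2) in \<open>auto simp: T_def\<close>)
    then show ?thesis using True h(1) by auto
  next
    case False
    obtain t where t: "z j \<le> t" "t \<le> z (Suc j)" "gapmax r z j = pot N r z t"
      using gapmax_attained[OF r z] by blast
    have "z 1 \<le> t" using config_mono[OF z, of 1 j] False t by auto
    moreover have "t \<le> z 0 + 2*pi"
      using config_mono[OF z, of "Suc j" "0 + N"] j t config_period[OF z, of 0] by auto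
    ultimately have "ereal (r 0) * K (t - z 0) + ereal (r 1) * K (t - z 1)
        < ereal (r 0) * K (t - Z h 0) + ereal (r 1) * K (t - Z h 1)"
      by (intro kernel_spread) (use h hpos r0 in \<open>auto simp: Z0 Z1[unfolded One_nat_def]\<close>)
    moreover have "z i = Z h i" if "i < N" "i \<noteq> 0" "i \<noteq> 1" for i
      using that by (simp add: Z_def v_def)
    ultimately have "pot N r z t = -\<infinity> \<or> pot N r z t < pot N r (Z h) t"
      by (intro pot_pair_less[OF r, of 1]) (use N in auto)
    moreover have "B \<le> pot N r z t" using B(2)[of j] t by simp
    moreover have "pot N r (Z h) t \<le> gapmax r (Z h) j"
      by (rule pot_le_gapmax) (use inner[of j] False j t in auto)
    ultimately show ?thesis using B(1) by auto
  qed
  then show ?thesis using conf by blast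
qed

section \<open>Uniqueness of equioscillating configurations\<close>

text \<open>
  Let s and t be maximum points of x in the gap before node N and of y in the gap after it. As all
  nodes of y lie to the left of those of x, concavity makes the potentials satisfy
  F y s + F x t > F y t + F x s, although the right-hand side is the sum of the two global maxima.
\<close>
lemma equioscillation_unique_aligned:
  assumes r: "weights r" and x: "config x" and y: "config y"
    and A: "\<And>j. gapmax r x j = topmax r x" and B: "\<And>j. gapmax r y j = topmax r y"
    and base: "x 0 = y 0" and le: "\<And>j. y j \<le> x j" and j: "j < N"
  shows "x j = y j"
proof (rule ccontr)
  assume "x j \<noteq> y j"
  then have less: "y j < x j" using le[of j] by simp
  \<comment> \<open>The gap before node 0 would have index -1; one period later it is the gap before
    node \<open>N\<close>.\<close>
  obtain s where s: "x (N - 1) \<le> s" "s \<le> x N" "topmax r x = pot N r x s"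
    using gapmax_attained[OF r x, of "N - 1"] A[of "N - 1"] N_pos by auto
  obtain t where t: "y N \<le> t" "t \<le> y (Suc N)" "topmax r y = pot N r y t"
    using gapmax_attained[OF r y, of N] B[of N] by auto
  have xyN: "x N = y N" using config_period[OF x, of 0] config_period[OF y, of 0] base by simp
  have "s \<noteq> t"
  proof
    assume "s = t"
    then have "t = y N" using s t xyN by simp
    then show False using node_lt_topmax[OF r y, of N] t by simp
  qed
  then have st: "s < t" using s t xyN by simp
  have fin: "\<bar>K (t - y i)\<bar> \<noteq> \<infinity>" "\<bar>K (s - x i)\<bar> \<noteq> \<infinity>" if "i < N" for i
  proof -
    have "pot N r y t \<noteq> -\<infinity>" "pot N r x s \<noteq> -\<infinity>"
      using topmax_not_MInf[OF r] s t by metis+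
    then have "K (t - y i) \<noteq> -\<infinity>" "K (s - x i) \<noteq> -\<infinity>"
      using pot_MInf_iff[of N r] r that by (auto simp: weights_pos)
    then show "\<bar>K (t - y i)\<bar> \<noteq> \<infinity>" "\<bar>K (s - x i)\<bar> \<noteq> \<infinity>"
      using kernel_not_PInf[of "t - y i"] kernel_not_PInf[of "s - x i"] by (auto simp: ereal_infinity_cases)
  qed
  have strict: "ereal (r i) * K (t - y i) + ereal (r i) * K (s - x i)
      < ereal (r i) * K (s - y i) + ereal (r i) * K (t - x i)" if i: "i < N" "y i < x i" for i
  proof -
    \<comment> \<open>Since \<open>x\<close> and \<open>y\<close> agree at index 0, only later
      indices occur; hence node \<open>i + N\<close> of \<open>y\<close> is not to the left of the
      gap's right end \<open>y (Suc N)\<close>.\<close>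
    have i0: "0 < i" using i base by (cases i) auto
    have 1: "0 \<le> s - x i" using config_mono[OF x, of i "N - 1"] i s(1) by linarith
    have "y (Suc N) \<le> y (i + N)" using i0 by (intro config_mono[OF y]) simp
    then have 2: "t - y i \<le> 2*pi" using t config_period[OF y, of i] by simp
    have "r i > 0" using r by (rule weights_pos)
    \<comment> \<open>The outer points are \<open>s - x i\<close> and \<open>t - y i\<close>; the
      order of the inner points \<open>t - x i\<close> and \<open>s - y i\<close> is not known, so
      both quadruples are needed.\<close>
    then show ?thesis
      using kernel_spread[of "s - x i" "t - x i" "s - y i" "t - y i" "r i" "r i"]
        kernel_spread[of "s - x i" "s - y i" "t - x i" "t - y i" "r i" "r i"] 1 2 i st
      by (cases "t - x i \<le> s - y i") (auto simp: add.commute)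
  qed
  have fin': "\<bar>K (s - y i)\<bar> \<noteq> \<infinity>" "\<bar>K (t - x i)\<bar> \<noteq> \<infinity>" if "i < N" for i
  proof -
    have "\<bar>K (s - y i)\<bar> \<noteq> \<infinity> \<and> \<bar>K (t - x i)\<bar> \<noteq> \<infinity>"
    proof (cases "y i = x i")
      case True
      then show ?thesis using fin[OF that] by simp
    next
      case False
      then have "y i < x i" using le[of i] by simp
      then show ?thesis
        using strict[OF that] weights_pos[OF r, of i] kernel_not_PInf[of "s - y i"] kernel_not_PInf[of "t - x i"]
        by (cases "K (s - y i)"; cases "K (t - x i)") auto
    qed
    then show "\<bar>K (s - y i)\<bar> \<noteq> \<infinity>" "\<bar>K (t - x i)\<bar> \<noteq> \<infinity>" by auto
  qed
  have strict': "r i * k (t - y i) + r i * k (s - x i) < r i * k (s - y i) + r i * k (t - x i)"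
    if i: "i < N" "y i < x i" for i
    using strict[OF i] fin[OF i(1)] fin'[OF i(1)]
    by (cases "K (t - y i)"; cases "K (s - x i)"; cases "K (s - y i)"; cases "K (t - x i)") auto
  have "(\<Sum>i<N. r i * k (t - y i) + r i * k (s - x i)) < (\<Sum>i<N. r i * k (s - y i) + r i * k (t - x i))"
  proof (rule sum_strict_mono_ex1)
    show "\<forall>i\<in>{..<N}. r i * k (t - y i) + r i * k (s - x i) \<le> r i * k (s - y i) + r i * k (t - x i)"
    proof
      fix i assume "i \<in> {..<N}"
      then show "r i * k (t - y i) + r i * k (s - x i) \<le> r i * k (s - y i) + r i * k (t - x i)"
        using strict'[of i] le[of i] by (cases "y i = x i") auto
    qed
    show "\<exists>i\<in>{..<N}. r i * k (t - y i) + r i * k (s - x i) < r i * k (s - y i) + r i * k (t - x i)"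
      using strict'[OF j less] j by blast
  qed simp
  moreover have "(\<Sum>i<N. r i * k (s - y i)) \<le> (\<Sum>i<N. r i * k (t - y i))"
    using pot_le_topmax[of r y s] t(3) fin fin' by (simp add: pot_real)
  moreover have "(\<Sum>i<N. r i * k (t - x i)) \<le> (\<Sum>i<N. r i * k (s - x i))"
    using pot_le_topmax[of r x t] s(3) fin fin' by (simp add: pot_real)
  ultimately show False by (simp add: sum.distrib)
qed

lemma equioscillation_unique:
  assumes r: "weights r" and x: "config x" and y: "config y"
    and A: "\<And>j. gapmax r x j = topmax r x" and B: "\<And>j. gapmax r y j = topmax r y"
    and base: "x 0 = y 0"
  shows "x = y"
proof -
  define d where "d j = y j - x j" for j
  have d_mult: "d (j + m * N) = d j" for j m
    using config_mult[OF x] config_mult[OF y] by (simp add: d_def)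
  have "Max (d ` {..<N}) \<in> d ` {..<N}" using N_pos by (intro Max_in) auto
  then obtain i where i: "i < N" "d i = Max (d ` {..<N})"
    by (metis imageE lessThan_iff)
  have d_le: "d j \<le> d i" for j
  proof -
    have "d (j mod N) \<le> d i" unfolding i(2) using N_pos by (intro Max_ge) auto
    then show ?thesis using d_mult[of "j mod N" "j div N"] by simp
  qed
  define x' where "x' = (\<lambda>j. rot i x j + d i)"
  have cx: "config x'" unfolding x'_def by (intro config_translate config_rot x)
  have eq: "x' j = rot i y j" if "j < N" for j
  proof (rule equioscillation_unique_aligned[OF weights_rot[OF r, of i] cx config_rot[OF y] _ _ _ _ that])
    show "gapmax (rot i r) x' j = topmax (rot i r) x'" for j
      unfolding x'_def gapmax_translate topmax_translate using A by (simp add: gapmax_rot topmax_rot r x)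
    show "gapmax (rot i r) (rot i y) j = topmax (rot i r) (rot i y)" for j
      using B by (simp add: gapmax_rot topmax_rot r y)
    show "x' 0 = rot i y 0" by (simp add: x'_def d_def)
    show "rot i y j \<le> x' j" for j using d_le[of "j + i"] by (simp add: x'_def d_def)
  qed
  have const: "d j = d i" for j
  proof -
    \<comment> \<open>\<open>p + i\<close> is congruent to \<open>j\<close> modulo \<open>N\<close>,
      which carries the equality from one period to all indices.\<close>
    define p where "p = (j + i * N - i) mod N"
    have "i \<le> j + i * N" using N_pos by (simp add: trans_le_add2)
    moreover have "p + ((j + i * N - i) div N) * N = j + i * N - i" by (simp add: p_def)
    ultimately have "(p + i) + ((j + i * N - i) div N) * N = j + i * N" by linarith
    then have "d (p + i) = d j" by (metis d_mult)
    moreover have "p < N" using N_pos by (simp add: p_def)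
    then have "d (p + i) = d i" using eq[of p] by (simp add: x'_def d_def)
    ultimately show ?thesis by simp
  qed
  have "d j = 0" for j
    using const[of j] const[of 0] base by (simp add: d_def)
  then show ?thesis by (simp add: d_def fun_eq_iff)
qed

section \<open>Extremal configurations\<close>

lemma exists_proper_gap:
  assumes z: "config z"
  shows "\<exists>q. z (i + q) < z (Suc (i + q))"
proof (rule ccontr)
  assume "\<not> ?thesis"
  then have step: "z (Suc (i + q)) \<le> z (i + q)" for q by (simp add: not_less)
  have "z (i + q) \<le> z i" for q
  proof (induction q)
    case (Suc q)
    then show ?case using step[of q] by simp
  qed simp
  from this[of N] show False using config_period[OF z, of i] pi_gt_zero by linarith
qed

text \<open>If all gaps are proper, the two nodes bounding the deficient gap \<open>i\<close> are
  spread. Otherwise a block of coinciding nodes is spread instead: its arc is a single point, where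
  the potential has a node value and so lies below \<open>topmax\<close>.\<close>

lemma topmax_minimizer_equioscillates:
  assumes r: "weights r" and z: "config z" and min: "\<And>z'. config z' \<Longrightarrow> topmax r z \<le> topmax r z'"
  shows "gapmax r z i = topmax r z"
proof (rule ccontr)
  assume "gapmax r z i \<noteq> topmax r z"
  then have gi: "gapmax r z i < topmax r z" using gapmax_le_topmax[of r z i] by simp
  have spread: False
    if l: "0 < l" "l < N" and gap: "z (N - 1 + p) < z (N + p)" "z (l + p) < z (Suc l + p)"
      and low: "\<And>t. z p \<le> t \<Longrightarrow> t \<le> z (l + p) \<Longrightarrow> pot N r z t < topmax r z" for p l
  proof -
    obtain z1 where z1: "config z1" "topmax (rot p r) z1 < topmax r z"
      using spread_nodes_lowers_topmax[OF weights_rot[OF r, of p] config_rot[OF z, of p] l] gap low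
      by (auto simp: pot_rot topmax_rot r z)
    obtain z2 where "config z2" "topmax r z2 = topmax (rot p r) z1"
      using unrotate[OF r z1(1), of p] by blast
    then show False using min[of z2] z1 by simp
  qed
  show False
  proof (cases "\<forall>j. z j < z (Suc j)")
    case True
    obtain j where j: "j < N" "topmax r z = gapmax r z j"
      by (rule topmax_eq_gapmax[OF r z])
    have "N \<noteq> 1"
    proof
      assume "N = 1"
      then have "gapmax r z i = gapmax r z j"
        using gapmax_mult[OF z, of r 0 i] j by simp
      then show False using gi j by simp
    qed
    then have "1 < N" using N_pos by simp
    moreover have "Suc (N - 1 + i) = N + i" using N_pos by simp
    ultimately show False
    proof (intro spread[of 1 i])
      show "pot N r z t < topmax r z" if "z i \<le> t" "t \<le> z (1 + i)" for t
        using pot_le_gapmax[of z i t r] that gi by auto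
      show "z (N - 1 + i) < z (N + i)" using True \<open>Suc (N - 1 + i) = N + i\<close> by metis
    qed (use True in auto)
  next
    case False
    then obtain j0 where j0: "\<not> z j0 < z (Suc j0)" by blast
    \<comment> \<open>A block starts where a proper gap is followed by a collapsed one. Without such
      a place, proper gaps would propagate to all later indices and, by periodicity, to
      \<open>j0\<close>.\<close>
    have "\<exists>p. z p < z (Suc p) \<and> \<not> z (Suc p) < z (Suc (Suc p))"
    proof (rule ccontr)
      assume "\<not> ?thesis"
      then have step: "z p < z (Suc p) \<Longrightarrow> z (Suc p) < z (Suc (Suc p))" for p by blast
      have "\<exists>q. z q < z (Suc q)"
        using exists_proper_gap[OF z, of 0] by blast
      then obtain q where q: "z q < z (Suc q)" by blast
      have "z (q + m) < z (Suc (q + m))" for m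
        by (induction m) (use q step in auto)
      moreover have "q \<le> j0 + q * N" using N_pos by (simp add: trans_le_add2)
      ultimately have "z (j0 + q * N) < z (Suc (j0 + q * N))"
        by (metis le_Suc_ex)
      then show False
        using j0 config_mult[OF z, of j0 q] config_mult[OF z, of "Suc j0" q] by simp
    qed
    then obtain p0 where p0: "z p0 < z (Suc p0)" "\<not> z (Suc p0) < z (Suc (Suc p0))" by blast
    define p where "p = Suc p0"
    \<comment> \<open>\<open>p + l\<close> is the last node of the block, so the gaps on both sides
      are proper, as spreading requires.\<close>
    define l where "l = (LEAST l. z p < z (Suc l + p))"
    have "z p < z (Suc (N - 1) + p)"
      using config_period[OF z, of p] N_pos by (simp add: add.commute)
    then have l: "z p < z (Suc l + p)" "l \<le> N - 1"
      unfolding l_def by (auto intro: LeastI Least_le)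
    have "l \<noteq> 0"
    proof
      assume "l = 0"
      then show False using l(1) p0(2) by (simp add: p_def)
    qed
    then obtain l' where l': "l = Suc l'" using not0_implies_Suc by blast
    have "\<not> z p < z (Suc l' + p)"
      using not_less_Least[of l' "\<lambda>l. z p < z (Suc l + p)"] l' unfolding l_def by simp
    then have zl: "z (l + p) = z p"
      using config_mono[OF z, of p "l + p"] l' by simp
    have "z (N - 1 + p) < z (N + p)"
    proof -
      have "z (p0 + N) < z (Suc p0 + N)"
        using p0(1) config_period[OF z, of p0] config_period[OF z, of "Suc p0"] by simp
      moreover have "N - 1 + p = p0 + N" "N + p = Suc p0 + N" using N_pos by (auto simp: p_def)
      ultimately show ?thesis by metis
    qed
    moreover have "pot N r z t < topmax r z" if "z p \<le> t" "t \<le> z (l + p)" for t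
      using node_lt_topmax[OF r z, of p] that zl by simp
    ultimately show False
      using l \<open>l \<noteq> 0\<close> N_pos zl by (intro spread[of l p]) auto
  qed
qed

text \<open>Only a proper gap can be contracted. If gap \<open>i\<close> is collapsed, the first
  proper gap after it starts at the same point, so its maximum exceeds \<open>B\<close> too.\<close>

lemma munder_maximizer_equioscillates:
  assumes r: "weights r" and z: "config z" and B: "B \<noteq> -\<infinity>" "\<And>j. B \<le> gapmax r z j"
    and max: "\<And>z'. config z' \<Longrightarrow> \<exists>j<N. gapmax r z' j \<le> B"
  shows "gapmax r z i = B"
proof (rule ccontr)
  assume "gapmax r z i \<noteq> B"
  then have gi: "B < gapmax r z i" using B(2)[of i] by simp
  define q where "q = (LEAST q. z (i + q) < z (Suc (i + q)))"
  have "\<exists>q. z (i + q) < z (Suc (i + q))"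
    by (rule exists_proper_gap[OF z])
  then have q: "z (i + q) < z (Suc (i + q))" unfolding q_def by (rule LeastI_ex)
  have eq: "z (i + q') = z i" if "q' \<le> q" for q'
    using that
  proof (induction q')
    case (Suc q')
    then have "\<not> z (i + q') < z (Suc (i + q'))"
      using not_less_Least[of q' "\<lambda>q. z (i + q) < z (Suc (i + q))"] unfolding q_def by simp
    then show ?case using Suc config_Suc[OF z, of "i + q'"] by simp
  qed simp
  define p where "p = i + q"
  have gp: "B < gapmax r z p"
  proof (cases "q = 0")
    case False
    then have "z (Suc i) = z i" using eq[of 1] by simp
    then have "gapmax r z i = pot N r z (z i)" by (simp add: gapmax_def)
    also have "\<dots> \<le> gapmax r z p"
      using eq[of q] q by (intro pot_le_gapmax) (auto simp: p_def)
    finally show ?thesis using gi by simp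
  qed (use gi p_def in simp)
  have "N \<noteq> 1"
  proof
    assume N1: "N = 1"
    obtain j where "j < N" "gapmax r z j \<le> B" using max[OF z] by blast
    then show False using gapmax_mult[OF z, of r 0 i] gi N1 by simp
  qed
  then have "1 < N" using N_pos by simp
  then obtain z1 where z1: "config z1" "\<And>j. j < N \<Longrightarrow> B < gapmax (rot p r) z1 j"
    using contract_gap_raises_others[OF weights_rot[OF r, of p] config_rot[OF z, of p] _ _ B(1)] B(2) gp q
    by (auto simp: gapmax_rot r z p_def)
  obtain z2 where z2: "config z2" "\<And>j. gapmax r z2 (j + p) = gapmax (rot p r) z1 j"
    using unrotate[OF r z1(1), of p] by blast
  obtain j where j: "j < N" "gapmax r z2 j \<le> B" using max[OF z2(1)] by blast
  define u where "u = (j + p * N - p)"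
  have "u + p = j + p * N" using N_pos by (simp add: u_def trans_le_add2)
  then have "gapmax r z2 j = gapmax (rot p r) z1 u"
    using z2(2)[of u] gapmax_mult[OF z2(1), of r j p] by simp
  also have "\<dots> = gapmax (rot p r) z1 (u mod N)"
    using gapmax_mult[OF z1(1), of "rot p r" "u mod N" "u div N"] by simp
  finally show False using j z1(2)[of "u mod N"] N_pos by simp
qed

section \<open>Compactness and existence of extremal configurations\<close>

definition normalized :: "(nat \<Rightarrow> real) set" where
  "normalized = {z. config z \<and> z 0 = 0}"

text \<open>The factor \<open>Suc i\<close> leaves room not only for node \<open>i\<close> but also
  for any point of the gap after it.\<close>

definition coord_box :: "(nat \<Rightarrow> real) set" where
  "coord_box = PiE UNIV (\<lambda>i. {0..real (Suc i) * (2*pi)})"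

lemma compact_coord_box: "compact coord_box"
proof -
  have "compactin (product_topology (\<lambda>i. euclidean) UNIV) coord_box"
    unfolding coord_box_def compactin_PiE by auto
  then show ?thesis
    by (simp add: euclidean_product_topology)
qed

lemma normalized_le:
  assumes "z \<in> normalized"
  shows "0 \<le> z i" "z i \<le> real i * (2*pi)"
proof -
  have z: "config z" "z 0 = 0" using assms by (auto simp: normalized_def)
  show "0 \<le> z i" using config_mono[OF z(1), of 0 i] z by simp
  have "i \<le> 0 + i * N" using N_pos by simp
  then have "z i \<le> z (0 + i * N)" by (rule config_mono[OF z(1)])
  then show "z i \<le> real i * (2*pi)" using config_mult[OF z(1), of 0 i] z by simp
qed

lemma normalized_subset_coord_box: "normalized \<subseteq> coord_box"
proof
  fix z assume z: "z \<in> normalized"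
  have "z i \<le> real (Suc i) * (2*pi)" for i
    using normalized_le[OF z, of i] by (simp add: algebra_simps) (smt (verit) pi_gt_zero)
  then show "z \<in> coord_box" using normalized_le[OF z] by (auto simp: coord_box_def)
qed

lemma closed_normalized: "closed normalized"
  unfolding normalized_def config_def
  by (intro closed_Collect_conj closed_Collect_all closed_Collect_le closed_Collect_eq continuous_intros) auto

lemma compact_normalized: "compact normalized"
  using compact_Int_closed[OF compact_coord_box closed_normalized] normalized_subset_coord_box
  by (simp add: Int_absorb1)

lemma equidistant_normalized: "(\<lambda>j. 2 * pi * real j / real N) \<in> normalized"
  using N_pos by (auto simp: normalized_def config_def field_simps)

lemma normalize:
  assumes "config z"
  shows "(\<lambda>j. z j + - z 0) \<in> normalized"
  using config_translate[OF assms, of "- z 0"] by (simp add: normalized_def)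

lemma continuous_pot_joint:
  assumes "weights r" "\<And>j. continuous_on S (\<lambda>p. w p j)" "continuous_on S u"
  shows "continuous_on S (\<lambda>p. pot N r (w p) (u p))"
  using assms unfolding continuous_on_def by (auto intro!: tendsto_pot)

text \<open>As a supremum of continuous functions \<open>topmax\<close> has closed sublevel sets.
  The best member of a finite family lies in all the sublevel sets of that family, and compactness
  extends this to all normalized configurations.\<close>

lemma exists_topmax_minimizer:
  assumes r: "weights r"
  obtains w where "w \<in> normalized" "\<And>z. config z \<Longrightarrow> topmax r w \<le> topmax r z"
proof -
  have "normalized \<inter> (\<Inter>z\<in>normalized. {w. \<forall>t. pot N r w t \<le> topmax r z}) \<noteq> {}"
  proof (rule compact_imp_fip_image[OF compact_normalized])
    show "closed {w. \<forall>t. pot N r w t \<le> topmax r z}" for z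
      by (intro closed_Collect_all closed_Collect_le continuous_pot_joint[OF r] continuous_intros) auto
    fix I' :: "(nat \<Rightarrow> real) set" assume I: "finite I'" "I' \<subseteq> normalized"
    show "normalized \<inter> (\<Inter>z\<in>I'. {w. \<forall>t. pot N r w t \<le> topmax r z}) \<noteq> {}"
    proof (cases "I' = {}")
      case True
      then show ?thesis using equidistant_normalized by auto
    next
      case False
      then have "Min (topmax r ` I') \<in> topmax r ` I'" using I by (intro Min_in) auto
      then obtain w where w: "w \<in> I'" "topmax r w = Min (topmax r ` I')" by (metis imageE)
      have "pot N r w t \<le> topmax r z" if "z \<in> I'" for z t
        using pot_le_topmax[of r w t] w I that by (metis Min_le finite_imageI imageI order_trans)
      then show ?thesis using w I by blast
    qed
  qed
  then obtain w where w: "w \<in> normalized" "\<And>z t. z \<in> normalized \<Longrightarrow> pot N r w t \<le> topmax r z"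
    by blast
  have "topmax r w \<le> topmax r z" if "config z" for z
  proof -
    have "topmax r w \<le> topmax r (\<lambda>j. z j + - z 0)"
      unfolding topmax_def[of r w] using w(2)[OF normalize[OF that]] by (intro SUP_least)
    then show ?thesis by (simp only: topmax_translate)
  qed
  then show thesis using that w(1) by blast
qed

lemma continuous_on_Min_image:
  fixes f :: "'i \<Rightarrow> 'a::topological_space \<Rightarrow> 'b::linorder_topology"
  assumes "finite A" "A \<noteq> {}" "\<And>j. j \<in> A \<Longrightarrow> continuous_on S (f j)"
  shows "continuous_on S (\<lambda>x. Min ((\<lambda>j. f j x) ` A))"
  using assms
proof (induction A rule: finite_ne_induct)
  case (insert a A)
  then have "continuous_on S (\<lambda>x. min (f a x) (Min ((\<lambda>j. f j x) ` A)))"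
    by (intro continuous_on_min) auto
  then show ?case using insert by simp
qed simp

text \<open>The interval in \<open>gapmax\<close> moves with the nodes. Taking a point of every gap
  as a further variable leaves a continuous function \<open>G\<close> on a compact set of pairs;
  inserting the maximum points of the gaps shows that nothing is lost.\<close>

lemma exists_munder_maximizer:
  assumes r: "weights r"
  obtains z B where "z \<in> normalized" "\<And>j. B \<le> gapmax r z j"
    "\<And>z'. config z' \<Longrightarrow> \<exists>j<N. gapmax r z' j \<le> B"
proof -
  define T where "T = {p. fst p \<in> normalized \<and> (\<forall>j. fst p j \<le> snd p j \<and> snd p j \<le> fst p (Suc j))}"
  define G where "G p = Min ((\<lambda>j. pot N r (fst p) (snd p j)) ` {..<N})"
    for p :: "(nat \<Rightarrow> real) \<times> (nat \<Rightarrow> real)"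
  have coord: "continuous_on S (\<lambda>p. fst p j)" "continuous_on S (\<lambda>p. snd p j)"
    for S :: "((nat \<Rightarrow> real) \<times> (nat \<Rightarrow> real)) set" and j
    by (rule continuous_on_compose2[OF continuous_on_product_coordinates[of j]
          continuous_on_fst[OF continuous_on_id]], simp)
      (rule continuous_on_compose2[OF continuous_on_product_coordinates[of j]
          continuous_on_snd[OF continuous_on_id]], simp)
  have "closed T"
  proof -
    have "closed (fst -` normalized :: ((nat \<Rightarrow> real) \<times> (nat \<Rightarrow> real)) set)"
      by (intro closed_vimage closed_normalized continuous_intros)
    moreover have "closed {p :: (nat \<Rightarrow> real) \<times> (nat \<Rightarrow> real). \<forall>j. fst p j \<le> snd p j \<and> snd p j \<le> fst p (Suc j)}"
      by (intro closed_Collect_all closed_Collect_conj closed_Collect_le coord)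
    moreover have "T = fst -` normalized \<inter> {p. \<forall>j. fst p j \<le> snd p j \<and> snd p j \<le> fst p (Suc j)}"
      by (auto simp: T_def)
    ultimately show ?thesis by (simp add: closed_Int)
  qed
  moreover have "T \<subseteq> coord_box \<times> coord_box"
  proof
    fix p assume p: "p \<in> T"
    have "0 \<le> snd p i \<and> snd p i \<le> real (Suc i) * (2*pi)" for i
      using p normalized_le[of "fst p" i] normalized_le[of "fst p" "Suc i"] unfolding T_def
      by (auto intro: order_trans)
    then have "snd p \<in> coord_box" by (auto simp: coord_box_def)
    moreover have "fst p \<in> coord_box" using p normalized_subset_coord_box by (auto simp: T_def)
    ultimately show "p \<in> coord_box \<times> coord_box" by (simp add: mem_Times_iff)
  qed
  ultimately have compact: "compact T"
    using compact_Int_closed[OF compact_Times[OF compact_coord_box compact_coord_box]] by (metis Int_absorb1)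
  have "(\<lambda>j. 2 * pi * real j / real N, \<lambda>j. 2 * pi * real j / real N) \<in> T"
    using equidistant_normalized by (auto simp: T_def normalized_def config_def)
  then have nonempty: "T \<noteq> {}" by blast
  have cont: "continuous_on T G"
    unfolding G_def using N_pos
    by (intro continuous_on_Min_image continuous_pot_joint[OF r] coord) auto
  obtain p where p: "p \<in> T" "\<And>p'. p' \<in> T \<Longrightarrow> G p' \<le> G p"
    using continuous_attains_sup[OF compact nonempty cont] by blast
  have conf: "config (fst p)" using p by (simp add: T_def normalized_def)
  have "G p \<le> gapmax r (fst p) j" for j
  proof -
    have "G p \<le> pot N r (fst p) (snd p (j mod N))"
      unfolding G_def using N_pos by (intro Min_le) auto
    also have "\<dots> \<le> gapmax r (fst p) (j mod N)"
      using p(1) by (intro pot_le_gapmax) (auto simp: T_def)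
    also have "\<dots> = gapmax r (fst p) j"
      using gapmax_mult[OF conf, of r "j mod N" "j div N"] by simp
    finally show ?thesis .
  qed
  moreover have "\<exists>j<N. gapmax r z j \<le> G p" if z: "config z" for z
  proof -
    define y where "y = (\<lambda>j. z j + - z 0)"
    have y: "y \<in> normalized" unfolding y_def by (rule normalize[OF z])
    then have cy: "config y" by (simp add: normalized_def)
    have "\<exists>t. y j \<le> t \<and> t \<le> y (Suc j) \<and> gapmax r y j = pot N r y t" for j
      using gapmax_attained[OF r cy] by metis
    then obtain \<tau> where \<tau>: "\<And>j. y j \<le> \<tau> j \<and> \<tau> j \<le> y (Suc j) \<and> gapmax r y j = pot N r y (\<tau> j)"
      by metis
    have "G (y, \<tau>) \<in> (\<lambda>j. pot N r (fst (y, \<tau>)) (snd (y, \<tau>) j)) ` {..<N}"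
      unfolding G_def using N_pos by (intro Min_in) auto
    then obtain j where "j < N" "G (y, \<tau>) = gapmax r y j" using \<tau> by auto
    moreover have "(y, \<tau>) \<in> T" using y \<tau> by (simp add: T_def)
    ultimately have "j < N" "gapmax r y j \<le> G p" using p(2) by metis+
    then show ?thesis unfolding y_def gapmax_translate by blast
  qed
  ultimately show thesis using that[of "fst p" "G p"] p by (auto simp: T_def)
qed

text \<open>Uniqueness is the link between the two problems. The maximizer equioscillates at
  \<open>B\<close>; one of its gaps carries its global maximum, so \<open>B\<close> is its
  \<open>topmax\<close>, and the maximizer is \<open>w\<close>.\<close>

theorem cyclic_minimax:
  assumes r: "weights r"
  obtains w where "config w" "w 0 = 0" "\<And>j. w j < w (Suc j)" "\<And>j. gapmax r w j = topmax r w"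
    "\<And>z. config z \<Longrightarrow> topmax r w \<le> topmax r z"
    "\<And>z. config z \<Longrightarrow> z 0 = 0 \<Longrightarrow> topmax r z = topmax r w \<Longrightarrow> z = w"
    "\<And>z. config z \<Longrightarrow> \<exists>j<N. gapmax r z j \<le> topmax r w"
proof -
  obtain w where w: "w \<in> normalized" and min: "\<And>z. config z \<Longrightarrow> topmax r w \<le> topmax r z"
    using exists_topmax_minimizer[OF r] by blast
  have cw: "config w" and w0: "w 0 = 0" using w by (auto simp: normalized_def)
  have equi: "gapmax r w j = topmax r w" for j
    by (rule topmax_minimizer_equioscillates[OF r cw min])
  have "w j < w (Suc j)" for j
  proof (rule ccontr)
    assume "\<not> w j < w (Suc j)"
    then have "w (Suc j) = w j" using config_Suc[OF cw, of j] by simp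
    then have "gapmax r w j = pot N r w (w j)" by (simp add: gapmax_def)
    then show False using equi[of j] node_lt_topmax[OF r cw, of j] by simp
  qed
  moreover have "z = w" if z: "config z" "z 0 = 0" "topmax r z = topmax r w" for z
  proof (rule equioscillation_unique[OF r z(1) cw _ equi])
    show "gapmax r z j = topmax r z" for j
      using min z by (intro topmax_minimizer_equioscillates[OF r z(1)]) auto
    show "z 0 = w 0" using z w0 by simp
  qed
  moreover have "\<exists>j<N. gapmax r z j \<le> topmax r w" if z: "config z" for z
  proof -
    obtain x B where x: "x \<in> normalized" "\<And>j. B \<le> gapmax r x j"
      and max: "\<And>z'. config z' \<Longrightarrow> \<exists>j<N. gapmax r z' j \<le> B"
      using exists_munder_maximizer[OF r] by blast
    have cx: "config x" "x 0 = 0" using x by (auto simp: normalized_def)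
    \<comment> \<open>\<open>w\<close> itself competes in the maximin problem with all its gap
      maxima equal; this keeps \<open>B\<close> above -infinity.\<close>
    have "topmax r w \<le> B" using max[OF cw] equi by auto
    then have "B \<noteq> -\<infinity>" using topmax_not_MInf[OF r, of w] by auto
    then have xB: "gapmax r x j = B" for j
      by (rule munder_maximizer_equioscillates[OF r cx(1) _ x(2) max])
    then have xt: "gapmax r x j = topmax r x" for j
      using topmax_eq_gapmax[OF r cx(1)] by metis
    have "x = w"
      by (rule equioscillation_unique[OF r cx(1) cw xt equi]) (simp add: cx w0)
    then have "B = topmax r w" using xB equi by metis
    then show ?thesis using max[OF z] by simp
  qed
  ultimately show thesis using that cw w0 equi min by blast
qed

end

section \<open>Simplices\<close>

locale simplex_problem = cyclic_kernel K "Suc n" for K :: "real \<Rightarrow> ereal" and n :: nat +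
  fixes r :: "nat \<Rightarrow> real" and \<sigma> :: "nat \<Rightarrow> nat"
  assumes r_pos: "\<forall>j\<le>n. r j > 0" and perm: "\<sigma> permutes {1..n}"
begin

definition weight :: "nat \<Rightarrow> real" where
  "weight i = r (\<sigma> (i mod Suc n))"

definition lift :: "(nat \<Rightarrow> real) \<Rightarrow> nat \<Rightarrow> real" where
  "lift y i = node n y (\<sigma> (i mod Suc n)) + real (i div Suc n) * (2*pi)"

text \<open>The restriction makes the result extensional, so that points of the simplex are
  recovered exactly.\<close>

definition unlift :: "(nat \<Rightarrow> real) \<Rightarrow> nat \<Rightarrow> real" where
  "unlift z = (\<lambda>j\<in>{1..n}. z (inv \<sigma> j))"

lemma perm_0 [simp]: "\<sigma> 0 = 0" and perm_Suc_n [simp]: "\<sigma> (Suc n) = Suc n"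
  using perm by (auto intro: permutes_not_in)

lemma perm_in: "1 \<le> i \<Longrightarrow> i \<le> n \<Longrightarrow> 1 \<le> \<sigma> i \<and> \<sigma> i \<le> n"
  using permutes_in_image[OF perm, of i] by auto

lemma perm_le: "i \<le> n \<Longrightarrow> \<sigma> i \<le> n"
  using perm_in[of i] by (cases "i = 0") auto

lemma inv_perm [simp]: "inv \<sigma> (\<sigma> i) = i" "\<sigma> (inv \<sigma> i) = i"
  using permutes_inverses[OF perm] by auto

lemma bij_perm: "bij_betw \<sigma> {..<Suc n} {..<Suc n}"
proof -
  have "\<sigma> permutes {..<Suc n}"
    using perm by (rule permutes_subset) auto
  then show ?thesis by (rule permutes_imp_bij)
qed

lemma perm_image: "\<sigma> ` {0..n} = {0..n}"
  using bij_betw_imp_surj_on[OF bij_perm] by (simp add: lessThan_Suc_atMost atMost_atLeast0)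

lemma weights_weight: "weights weight"
proof -
  have "weight (j + Suc n) = weight j" for j
    unfolding weight_def by (simp only: mod_add_self2)
  moreover have "weight j > 0" for j
    using r_pos perm_le[of "j mod Suc n"] by (simp add: weight_def less_Suc_eq_le)
  ultimately show ?thesis by (simp only: weights_def simp_thms)
qed

text \<open>At \<open>i = Suc n\<close> the quotient adds one full turn to node 0, in agreement with
  the convention that node \<open>n + 1\<close> is \<open>2*pi\<close>.\<close>

lemma lift_eq: "i \<le> Suc n \<Longrightarrow> lift y i = node n y (\<sigma> i)"
  by (cases "i = Suc n") (auto simp: lift_def node_def)

lemma sumF_eq_pot: "sumF K r n y t = pot (Suc n) weight (lift y) t"
proof -
  have "pot (Suc n) weight (lift y) t = (\<Sum>i<Suc n. ereal (r (\<sigma> i)) * K (t - node n y (\<sigma> i)))"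
    unfolding pot_def by (intro sum.cong) (auto simp: weight_def lift_eq)
  also have "\<dots> = (\<Sum>j<Suc n. ereal (r j) * K (t - node n y j))"
    by (rule sum.reindex_bij_betw[OF bij_perm])
  also have "\<dots> = ereal (r 0) * K (t - node n y 0) + (\<Sum>j\<in>{1..n}. ereal (r j) * K (t - node n y j))"
  proof -
    have "{..<Suc n} = insert 0 {1..n}" by auto
    then show ?thesis by simp
  qed
  also have "\<dots> = sumF K r n y t"
    unfolding sumF_def by (intro arg_cong2[where f="(+)"] sum.cong) (auto simp: node_def)
  finally show ?thesis by simp
qed

lemma config_lift:
  assumes "y \<in> closed_simplex_S n \<sigma>"
  shows "config (lift y)"
proof (rule configI)
  show "lift y (j + Suc n) = lift y j + 2*pi" for j
    using div_add_self2[of "Suc n" j] mod_add_self2[of j "Suc n"]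
    by (simp del: add_Suc_right add: lift_def algebra_simps)
  show "lift y j \<le> lift y (Suc j)" if "j < Suc n" for j
    using that assms lift_eq[of j y] lift_eq[of "Suc j" y] by (auto simp: closed_simplex_S_def)
qed

lemma lift_0: "lift y 0 = 0"
  by (simp add: lift_def node_def)

lemma simplex_subset_closed: "simplex_S n \<sigma> \<subseteq> closed_simplex_S n \<sigma>"
  by (auto simp: simplex_S_def closed_simplex_S_def less_imp_le)

lemma mloc_eq_gapmax: "i \<le> n \<Longrightarrow> mloc K r n \<sigma> y (\<sigma> i) = gapmax weight (lift y) i"
  by (simp add: mloc_def Ival_def gapmax_def sumF_eq_pot lift_eq)

text \<open>Node labels and positions on the circle differ by a permutation of
  \<open>{0..n}\<close>, and \<open>mbar\<close> and \<open>munder\<close> depend only on the set of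
  values.\<close>

lemma mloc_image: "mloc K r n \<sigma> y ` {0..n} = gapmax weight (lift y) ` {0..n}"
proof -
  have "mloc K r n \<sigma> y ` {0..n} = mloc K r n \<sigma> y ` \<sigma> ` {0..n}"
    by (simp only: perm_image)
  also have "\<dots> = gapmax weight (lift y) ` {0..n}"
    unfolding image_image by (intro image_cong) (auto simp: mloc_eq_gapmax)
  finally show ?thesis .
qed

lemma SUP_sumF_eq_topmax: "(SUP t\<in>{0..<2*pi}. sumF K r n y t) = topmax weight (lift y)"
proof (rule antisym)
  show "(SUP t\<in>{0..<2*pi}. sumF K r n y t) \<le> topmax weight (lift y)"
    by (intro SUP_least) (simp add: sumF_eq_pot pot_le_topmax)
  obtain t where t: "topmax weight (lift y) = pot (Suc n) weight (lift y) t"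
    by (rule topmax_attained[OF weights_weight])
  obtain s where s: "0 \<le> s" "s < 0 + 2*pi" "pot (Suc n) weight (lift y) t = pot (Suc n) weight (lift y) s"
    using reduce_to_window[of 0 t] by metis
  then have "pot (Suc n) weight (lift y) s \<le> (SUP t\<in>{0..<2*pi}. sumF K r n y t)"
    unfolding sumF_eq_pot by (intro SUP_upper) auto
  then show "topmax weight (lift y) \<le> (SUP t\<in>{0..<2*pi}. sumF K r n y t)"
    using t s by simp
qed

text \<open>The gaps cover a whole period, so the first equality of (b) holds already for each
  single \<open>y\<close>.\<close>

lemma mbar_eq_topmax:
  assumes "y \<in> closed_simplex_S n \<sigma>"
  shows "mbar K r n \<sigma> y = topmax weight (lift y)"
proof -
  obtain j where "j < Suc n" "topmax weight (lift y) = gapmax weight (lift y) j"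
    by (rule topmax_eq_gapmax[OF weights_weight config_lift[OF assms]])
  then have "topmax weight (lift y) \<in> gapmax weight (lift y) ` {0..n}" by auto
  moreover have "u \<le> topmax weight (lift y)" if "u \<in> gapmax weight (lift y) ` {0..n}" for u
    using that gapmax_le_topmax by blast
  ultimately show ?thesis
    unfolding mbar_def mloc_image by (intro Max_eqI) simp_all
qed

lemma munder_le:
  assumes "j < Suc n"
  shows "munder K r n \<sigma> y \<le> gapmax weight (lift y) j"
  unfolding munder_def mloc_image using assms by (intro Min_le) auto

lemma node_unlift: "z 0 = 0 \<Longrightarrow> i \<le> n \<Longrightarrow> node n (unlift z) (\<sigma> i) = z i"
  using perm_in[of i] by (cases "i = 0") (auto simp: node_def unlift_def)

lemma lift_unlift:
  assumes "config z" "z 0 = 0"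
  shows "lift (unlift z) = z"
proof
  fix i
  have "lift (unlift z) i = z (i mod Suc n) + real (i div Suc n) * (2*pi)"
    unfolding lift_def using assms by (simp add: node_unlift less_Suc_eq_le)
  also have "\<dots> = z i"
    using config_mult[OF assms(1), of "i mod Suc n" "i div Suc n"] by (simp only: mod_div_mult_eq)
  finally show "lift (unlift z) i = z i" .
qed

lemma unlift_in_simplex:
  assumes "config z" "z 0 = 0" "\<And>j. z j < z (Suc j)"
  shows "unlift z \<in> simplex_S n \<sigma>"
proof -
  have "node n (unlift z) (\<sigma> i) < node n (unlift z) (\<sigma> (Suc i))" if "i \<le> n" for i
    using that assms(3)[of i] lift_eq[of i "unlift z"] lift_eq[of "Suc i" "unlift z"]
    by (simp add: lift_unlift[OF assms(1,2)])
  moreover have "unlift z \<in> PiE {1..n} (\<lambda>_. UNIV)"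
    unfolding unlift_def by simp
  ultimately show ?thesis unfolding simplex_S_def by simp
qed

lemma unlift_lift:
  assumes "y \<in> closed_simplex_S n \<sigma>"
  shows "unlift (lift y) = y"
proof
  fix j
  show "unlift (lift y) j = y j"
  proof (cases "j \<in> {1..n}")
    case True
    have "inv \<sigma> j \<in> {1..n}"
      using permutes_in_image[OF permutes_inv[OF perm], of j] True by simp
    then show ?thesis using True by (simp add: unlift_def lift_eq node_def)
  next
    case False
    then show ?thesis using assms by (auto simp: unlift_def closed_simplex_S_def PiE_def extensional_def)
  qed
qed

lemma inj_on_node:
  assumes "config z" "z 0 = 0" "\<And>j. z j < z (Suc j)"
  shows "inj_on (node n (unlift z)) {0..n}"
proof -
  have "strict_mono z" using assms(3) by (simp add: strict_mono_Suc_iff)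
  then have "inj_on z {0..n}" by (intro inj_on_subset[OF strict_mono_imp_inj_on]) auto
  moreover have "inj_on (\<lambda>i. node n (unlift z) (\<sigma> i)) {0..n} \<longleftrightarrow> inj_on z {0..n}"
    using assms(2) by (intro inj_on_cong) (simp add: node_unlift)
  ultimately have "inj_on (node n (unlift z) \<circ> \<sigma>) {0..n}" by (simp add: o_def)
  then have "inj_on (node n (unlift z)) (\<sigma> ` {0..n})" by (rule inj_on_imageI)
  then show ?thesis by (simp only: perm_image)
qed

end

theorem theorem13p1:
  fixes K :: "real \<Rightarrow> ereal" and r :: "nat \<Rightarrow> real" and n :: nat and \<sigma> :: "nat \<Rightarrow> nat"
  assumes "strictly_concave_kernel K"
    and "cond_infty' K \<or> C1_kernel K"
    and "\<forall>j\<le>n. r j > 0"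
    and "\<sigma> permutes {1..n}"
  shows "\<exists>w. (w \<in> simplex_S n \<sigma> \<and> minimax K r n \<sigma> = (SUP t\<in>{0..<2*pi}. sumF K r n w t))
          \<and> (\<forall>w'. w' \<in> simplex_S n \<sigma> \<and> minimax K r n \<sigma> = (SUP t\<in>{0..<2*pi}. sumF K r n w' t)
                 \<longrightarrow> w' = w)
          \<and> inj_on (node n w) {0..n}
          \<and> (\<forall>j\<le>n. mloc K r n \<sigma> w j = mloc K r n \<sigma> w 0)
          \<and> (INF y\<in>simplex_S n \<sigma>. mbar K r n \<sigma> y) = minimax K r n \<sigma>
          \<and> minimax K r n \<sigma> = maximin K r n \<sigma>
          \<and> maximin K r n \<sigma> = (SUP y\<in>simplex_S n \<sigma>. munder K r n \<sigma> y)
          \<and> (\<forall>x\<in>closed_simplex_S n \<sigma>. \<forall>y\<in>closed_simplex_S n \<sigma>.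
                munder K r n \<sigma> x \<le> minimax K r n \<sigma> \<and> minimax K r n \<sigma> \<le> mbar K r n \<sigma> y)"
proof -
  interpret simplex_problem K n r \<sigma>
    using assms by unfold_locales auto
  obtain w where w: "config w" "w 0 = 0" "\<And>j. w j < w (Suc j)"
    and equi: "\<And>j. gapmax weight w j = topmax weight w"
    and min: "\<And>z. config z \<Longrightarrow> topmax weight w \<le> topmax weight z"
    and uniq: "\<And>z. config z \<Longrightarrow> z 0 = 0 \<Longrightarrow> topmax weight z = topmax weight w \<Longrightarrow> z = w"
    and max: "\<And>z. config z \<Longrightarrow> \<exists>j<Suc n. gapmax weight z j \<le> topmax weight w"
    using cyclic_minimax[OF weights_weight] by blast
  define M where "M = topmax weight w"
  define W where "W = unlift w"
  have W: "W \<in> simplex_S n \<sigma>" unfolding W_def by (rule unlift_in_simplex[OF w])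
  have lW: "lift W = w" unfolding W_def by (rule lift_unlift[OF w(1,2)])
  \<comment> \<open>Both bounds hold on the closed simplex, since configurations may have coinciding
    nodes; together they are the Sandwich Property.\<close>
  have lower: "M \<le> topmax weight (lift y)" if "y \<in> closed_simplex_S n \<sigma>" for y
    unfolding M_def by (rule min[OF config_lift[OF that]])
  have upper: "munder K r n \<sigma> y \<le> M" if y: "y \<in> closed_simplex_S n \<sigma>" for y
    using max[OF config_lift[OF y]] munder_le[of _ y] unfolding M_def by (metis order_trans)
  have minimax: "minimax K r n \<sigma> = M"
    unfolding minimax_def SUP_sumF_eq_topmax
  proof (rule antisym)
    show "(INF y\<in>simplex_S n \<sigma>. topmax weight (lift y)) \<le> M"
      using W lW by (intro INF_lower2[of W]) (auto simp: M_def)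
    show "M \<le> (INF y\<in>simplex_S n \<sigma>. topmax weight (lift y))"
      using lower simplex_subset_closed by (intro INF_greatest) auto
  qed
  have mloc: "mloc K r n \<sigma> W j = M" if "j \<le> n" for j
  proof -
    have "mloc K r n \<sigma> W j \<in> gapmax weight w ` {0..n}"
      using mloc_image[of W] that lW by auto
    then show ?thesis using equi by (auto simp: M_def)
  qed
  then have "mloc K r n \<sigma> W ` {0..n} = {M}" by auto
  then have munder_W: "munder K r n \<sigma> W = M" by (simp add: munder_def)
  have maximin: "maximin K r n \<sigma> = M"
    unfolding maximin_def
  proof (rule antisym)
    show "(SUP y\<in>simplex_S n \<sigma>. munder K r n \<sigma> y) \<le> M"
      using upper simplex_subset_closed by (intro SUP_least) auto
    show "M \<le> (SUP y\<in>simplex_S n \<sigma>. munder K r n \<sigma> y)"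
      using W munder_W by (intro SUP_upper2[of W]) auto
  qed
  have sup_W: "(SUP t\<in>{0..<2*pi}. sumF K r n W t) = M"
    by (simp add: SUP_sumF_eq_topmax lW M_def)
  have unique: "y = W" if y: "y \<in> simplex_S n \<sigma>" "M = (SUP t\<in>{0..<2*pi}. sumF K r n y t)" for y
  proof -
    have yc: "y \<in> closed_simplex_S n \<sigma>" using y simplex_subset_closed by auto
    have "topmax weight (lift y) = topmax weight w"
      using y(2) by (simp only: SUP_sumF_eq_topmax M_def)
    then have "lift y = w" by (intro uniq config_lift[OF yc] lift_0)
    then show ?thesis unfolding W_def using unlift_lift[OF yc] by simp
  qed
  show ?thesis
    unfolding minimax maximin
  proof (intro exI[of _ W] conjI allI impI ballI)
    show "M = (SUP t\<in>{0..<2*pi}. sumF K r n W t)" using sup_W by simp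
    show "y = W" if "y \<in> simplex_S n \<sigma> \<and> M = (SUP t\<in>{0..<2*pi}. sumF K r n y t)" for y
      using unique that by blast
    show "inj_on (node n W) {0..n}" unfolding W_def by (rule inj_on_node[OF w])
    show "mloc K r n \<sigma> W j = mloc K r n \<sigma> W 0" if "j \<le> n" for j
      using mloc[OF that] mloc[of 0] by simp
    have "(INF y\<in>simplex_S n \<sigma>. mbar K r n \<sigma> y) = minimax K r n \<sigma>"
      unfolding minimax_def SUP_sumF_eq_topmax
      using simplex_subset_closed by (intro INF_cong) (auto simp: mbar_eq_topmax)
    then show "(INF y\<in>simplex_S n \<sigma>. mbar K r n \<sigma> y) = M" unfolding minimax .
    show "M = (SUP y\<in>simplex_S n \<sigma>. munder K r n \<sigma> y)"
      unfolding maximin[symmetric] by (rule maximin_def)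
    show "munder K r n \<sigma> x \<le> M" if "x \<in> closed_simplex_S n \<sigma>" for x
      by (rule upper[OF that])
    show "M \<le> mbar K r n \<sigma> y" if "y \<in> closed_simplex_S n \<sigma>" for y
      unfolding mbar_eq_topmax[OF that] by (rule lower[OF that])
  qed (rule W refl)+
qed

end
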